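(* Let $M$ be a positive integer and let $q\in(q_{KL},M+1]\setminus\bigcup(p_L,p_R]$, where the union runs over all entropy plateaus $[p_L,p_R]$. Then for every open set $V\subseteq\mathbb R$ with $\mathcal U_q\cap V\neq\emptyset$ we have \[\dim_H(\mathcal U_q\cap V)=\dim_H\mathcal U_q .\]
   Context: Fix a positive integer $M$; all sequences have digits in $\{0,1,\dots,M\}$. For $q>1$ and $(x_i)\in\{0,\dots,M\}^{\mathbb N}$ put $\pi_q((x_i))=\sum_{i\ge1}x_iq^{-i}$. For $q\in(1,M+1]$, a $q$-expansion of $x$ is a sequence $(x_i)$ with $\pi_q((x_i))=x$, and $\mathcal U_q$ is the set of $x\in[0,M/(q-1)]$ having exactly one $q$-expansion. Let $\alpha(q)=\alpha_1(q)\alpha_2(q)\dots$ be the quasi-greedy $q$-expansion of $1$, i.e. the lexicographically largest $q$-expansion of $1$ not ending in $0^\infty$. Sequences are compared lexicographically ($\prec,\preccurlyeq$); the reflection of $(x_i)$ is $\overline{(x_i)}=(M-x_1)(M-x_2)\dots$; $\sigma$ is the left shift. Let $\mathbf V_q$ be the set of sequences $(x_i)$ with $\overline{\alpha(q)}\preccurlyeq\sigma^n((x_i))\preccurlyeq\alpha(q)$ for all $n\ge0$, and $H(q)=h_{top}(\mathbf V_q)=\lim_{n\to\infty}\frac1n\log\#\{\text{words of length }n\text{ occurring in sequences of }\mathbf V_q\}$. Let $(\tau_i)_{i\ge0}$ be the Thue–Morse sequence ($\tau_0=0$ and $\tau_{2^n}\dots\tau_{2^{n+1}-1}=(1-\tau_0)\dots(1-\tau_{2^n-1})$).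 The Komornik–Loreti constant $q_{KL}\in(1,M+1]$ is the base with $\alpha(q_{KL})=\lambda_1\lambda_2\dots$, where $\lambda_i=k+\tau_i-\tau_{i-1}$ if $M=2k$ and $\lambda_i=k+\tau_i$ if $M=2k+1$. Let $\mathcal B=\{q\in(1,M+1]: H(p)\ne H(q)\text{ for all }p\ne q\}$ and $\overline{\mathcal B}$ its closure. An entropy plateau is an interval $[p_L,p_R]$ such that $(p_L,p_R)$ is a connected component of $(q_{KL},M+1]\setminus\overline{\mathcal B}$. *)

theory Defs
  imports "HOL-Analysis.Analysis"
begin

text \<open>Sequences are indexed from 0: the paper's digit x_i (i \<ge> 1) is x (i-1) here.\<close>

definition digits :: "nat \<Rightarrow> (nat \<Rightarrow> nat) \<Rightarrow> bool" where
  "digits M x \<longleftrightarrow> (\<forall>i. x i \<le> M)"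

definition proj :: "real \<Rightarrow> (nat \<Rightarrow> nat) \<Rightarrow> real" where
  "proj q x = (\<Sum>i. real (x i) / q ^ Suc i)"

definition univoque :: "nat \<Rightarrow> real \<Rightarrow> real set" where
  "univoque M q = {x. 0 \<le> x \<and> x \<le> real M / (q - 1) \<and> (\<exists>!s. digits M s \<and> proj q s = x)}"

definition lex_less :: "(nat \<Rightarrow> nat) \<Rightarrow> (nat \<Rightarrow> nat) \<Rightarrow> bool" where
  "lex_less x y \<longleftrightarrow> (\<exists>n. (\<forall>i<n. x i = y i) \<and> x n < y n)"

definition lex_le :: "(nat \<Rightarrow> nat) \<Rightarrow> (nat \<Rightarrow> nat) \<Rightarrow> bool" where
  "lex_le x y \<longleftrightarrow> x = y \<or> lex_less x y"

definition reflect :: "nat \<Rightarrow> (nat \<Rightarrow> nat) \<Rightarrow> (nat \<Rightarrow> nat)" where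
  "reflect M x = (\<lambda>i. M - x i)"

definition shift :: "nat \<Rightarrow> (nat \<Rightarrow> nat) \<Rightarrow> (nat \<Rightarrow> nat)" where
  "shift n x = (\<lambda>i. x (i + n))"

definition quasi_greedy :: "nat \<Rightarrow> real \<Rightarrow> (nat \<Rightarrow> nat)" where
  "quasi_greedy M q = (THE a. digits M a \<and> proj q a = 1 \<and> infinite {i. a i \<noteq> 0} \<and>
      (\<forall>b. digits M b \<and> proj q b = 1 \<and> infinite {i. b i \<noteq> 0} \<longrightarrow> lex_le b a))"

definition Vq :: "nat \<Rightarrow> real \<Rightarrow> (nat \<Rightarrow> nat) set" where
  "Vq M q = {x. digits M x \<and> (\<forall>n. lex_le (reflect M (quasi_greedy M q)) (shift n x)
                                 \<and> lex_le (shift n x) (quasi_greedy M q))}"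

definition words :: "(nat \<Rightarrow> nat) set \<Rightarrow> nat \<Rightarrow> nat list set" where
  "words X n = {map (\<lambda>i. x (k + i)) [0..<n] | x k. x \<in> X}"

definition entropy :: "nat \<Rightarrow> real \<Rightarrow> real" where
  "entropy M q = lim (\<lambda>n. ln (real (card (words (Vq M q) n))) / real n)"

fun thue_morse :: "nat \<Rightarrow> nat" where
  "thue_morse n = (if n = 0 then 0 else if even n then thue_morse (n div 2)
                   else 1 - thue_morse (n div 2))"

text \<open>lambda_i for i \<ge> 1.\<close>
definition kl_digit :: "nat \<Rightarrow> nat \<Rightarrow> nat" where
  "kl_digit M i = (if even M
      then nat (int (M div 2) + int (thue_morse i) - int (thue_morse (i - 1)))
      else M div 2 + thue_morse i)"

definition q_KL :: "nat \<Rightarrow> real" where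
  "q_KL M = (THE q. 1 < q \<and> q \<le> real M + 1 \<and> quasi_greedy M q = (\<lambda>i. kl_digit M (Suc i)))"

definition bifset :: "nat \<Rightarrow> real set" where
  "bifset M = {q \<in> {1<..real M + 1}. \<forall>p \<in> {1<..real M + 1}. p \<noteq> q \<longrightarrow> entropy M p \<noteq> entropy M q}"

definition entropy_plateau :: "nat \<Rightarrow> real \<Rightarrow> real \<Rightarrow> bool" where
  "entropy_plateau M pL pR \<longleftrightarrow>
     {pL<..<pR} \<in> components ({q_KL M<..real M + 1} - closure (bifset M))"

definition hausdorff_premeasure :: "real \<Rightarrow> real \<Rightarrow> 'a::metric_space set \<Rightarrow> ennreal" where
  "hausdorff_premeasure s \<delta> A =
     (INF C \<in> {C :: nat \<Rightarrow> 'a set. A \<subseteq> (\<Union>i. C i) \<and> (\<forall>i. bounded (C i) \<and> diameter (C i) \<le> \<delta>)}.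
        \<Sum>i. ennreal (diameter (C i) powr s))"

definition hausdorff_measure :: "real \<Rightarrow> 'a::metric_space set \<Rightarrow> ennreal" where
  "hausdorff_measure s A = (SUP \<delta> \<in> {0<..}. hausdorff_premeasure s \<delta> A)"

definition hausdorff_dim :: "'a::metric_space set \<Rightarrow> real" where
  "hausdorff_dim A = Inf {s. 0 \<le> s \<and> hausdorff_measure s A = 0}"

end

theory Submission
  imports Defs
begin

text \<open>
  Outside the half-open plateaus the bifurcation set accumulates at \<open>q\<close> from the left, so
  \<open>H(p) < H(q)\<close> for every \<open>p < q\<close>. Put \<open>z = exp (- H(q))\<close>, and let \<open>N\<^sub>n(w)\<close> be the number of words of
  length \<open>n\<close> that begin a sequence \<open>y\<close> with \<open>w y\<close> in the symmetric subshift of \<open>q\<close>. Since \<open>\<alpha>\<close> is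
  left-continuous in the base, words avoiding a fixed prefix of \<open>\<alpha>(q)\<close> and its reflection grow like those
  of a smaller base, hence exponentially more slowly than \<open>exp (n H(q))\<close>. Splitting words at the first
  occurrence of that prefix shows that the partial sums of \<open>N\<^sub>n(w) z\<^sup>n\<close> are comparable to those for the
  empty word as soon as \<open>w\<close> has any continuation. Consequently every cover of a nonempty cylinder by
  cylinders \<open>[u]\<close> has total weight \<open>\<Sum>z\<^bsup>|u|\<^esup>\<close> bounded below. Below the maximal base, the values of two
  sequences that first differ at position \<open>n\<close> are separated by a constant times \<open>q\<^bsup>-n\<^esup>\<close>, which turns this
  into the lower bound \<open>H(q) / ln q\<close> for the dimension of each nonempty relatively open piece of the
  univoque set; for \<open>q = M + 1\<close> the univoque set is an interval minus a countable set. The matching upper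
  bound counts cylinders, because every nonconstant unique expansion eventually enters the subshift.
\<close>

section \<open>Sequences and words\<close>

text \<open>Entropy is a global quantity, and the words following one particular \<open>w\<close>
  might a priori grow more slowly. This is controlled through partial sums at the critical weight
  \<open>z\<close>. By Fekete's lemma entropy is an infimum, so every term \<open>N_n z^n\<close>
  for the empty word is at least 1 and these sums are unbounded, whereas all that is lost on the way
  (words avoiding a prefix, finitely many short lengths) stays bounded in the number of terms.
  Comparing unbounded sums gives a cover bound whose constant depends on \<open>w\<close> alone; it
  takes the place of a mass distribution. A second obstacle is that the subshift is cut out by weak
  inequalities and uniqueness by strict ones. The discrepancy is confined to a countable set
  \<open>exceptional\<close>, which cylinders of arbitrarily small total weight cover. Finally, two
  sequences first differing at \<open>n\<close> are separated by a multiple of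
  \<open>M / (q - 1) - 1\<close>. This vanishes at \<open>q = M + 1\<close>, so Lebesgue measure
  handles that base.\<close>

definition pre :: "nat \<Rightarrow> (nat \<Rightarrow> nat) \<Rightarrow> nat list" where
  "pre n x = map x [0..<n]"

definition cat :: "nat list \<Rightarrow> (nat \<Rightarrow> nat) \<Rightarrow> nat \<Rightarrow> nat" where
  "cat w x = (\<lambda>i. if i < length w then w ! i else x (i - length w))"

lemma length_pre [simp]: "length (pre n x) = n"
  by (simp add: pre_def)

lemma pre_0 [simp]: "pre 0 x = []"
  by (simp add: pre_def)

lemma pre_nth [simp]: "i < n \<Longrightarrow> pre n x ! i = x i"
  by (simp add: pre_def)

lemma pre_eq_iff: "pre n x = pre n y \<longleftrightarrow> (\<forall>i<n. x i = y i)"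
  by (auto simp: pre_def)

lemma pre_eqD: "pre n x = pre n y \<Longrightarrow> i < n \<Longrightarrow> x i = y i"
  by (simp add: pre_eq_iff)

lemma pre_eq_mono: "pre n x = pre n y \<Longrightarrow> m \<le> n \<Longrightarrow> pre m x = pre m y"
  by (simp add: pre_eq_iff)

lemma pre_add: "pre (m + n) x = pre m x @ pre n (shift m x)"
  by (rule nth_equalityI) (auto simp: nth_append shift_def)

lemma pre_cat: "pre (length w + n) (cat w x) = w @ pre n x"
  by (rule nth_equalityI) (auto simp: nth_append cat_def)

lemma pre_length_cat [simp]: "pre (length w) (cat w x) = w"
  by (rule nth_equalityI) (auto simp: cat_def)

lemma cat_Nil [simp]: "cat [] x = x"
  by (simp add: cat_def)

lemma cat_pre_shift [simp]: "cat (pre n x) (shift n x) = x"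
  by (rule ext) (auto simp: cat_def shift_def)

lemma shift_0 [simp]: "shift 0 x = x"
  by (simp add: shift_def)

lemma shift_shift [simp]: "shift m (shift n x) = shift (m + n) x"
  by (simp add: shift_def add.assoc)

lemma shift_cat_length [simp]: "shift (length w) (cat w x) = x"
  by (simp add: cat_def shift_def)

lemma shift_cat: "n \<le> length w \<Longrightarrow> shift n (cat w x) = cat (drop n w) x"
  by (rule ext) (auto simp: cat_def shift_def add.commute less_diff_conv)

lemma shift_cat_ge: "length w \<le> n \<Longrightarrow> shift n (cat w x) = shift (n - length w) x"
  by (rule ext) (auto simp: cat_def shift_def)

lemma digits_shift: "digits M x \<Longrightarrow> digits M (shift n x)"
  by (simp add: digits_def shift_def)

lemma digitsD: "digits M x \<Longrightarrow> x i \<le> M"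
  by (simp add: digits_def)

lemma digits_cat: "digits M (cat w x) \<longleftrightarrow> set w \<subseteq> {..M} \<and> digits M x"
proof
  assume h: "digits M (cat w x)"
  have "set w \<subseteq> {..M}"
  proof
    fix d assume "d \<in> set w"
    then obtain i where "i < length w" "w ! i = d" by (auto simp: in_set_conv_nth)
    then show "d \<in> {..M}" using digitsD[OF h, of i] by (simp add: cat_def)
  qed
  with digits_shift[OF h, of "length w"] show "set w \<subseteq> {..M} \<and> digits M x" by simp
next
  assume "set w \<subseteq> {..M} \<and> digits M x"
  then show "digits M (cat w x)" by (auto simp: digits_def cat_def subset_iff)
qed

lemma set_pre: "digits M x \<Longrightarrow> set (pre n x) \<subseteq> {..M}"
  by (auto simp: pre_def digits_def)

lemma digits_reflect [simp]: "digits M (reflect M x)"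
  by (simp add: digits_def reflect_def)

lemma reflect_reflect [simp]: "digits M x \<Longrightarrow> reflect M (reflect M x) = x"
  by (auto simp: digits_def reflect_def)

lemma shift_reflect: "shift n (reflect M x) = reflect M (shift n x)"
  by (simp add: shift_def reflect_def)

lemma reflect_cat: "reflect M (cat w x) = cat (map (\<lambda>d. M - d) w) (reflect M x)"
  by (auto simp: cat_def reflect_def fun_eq_iff)

lemma pre_reflect: "pre n (reflect M x) = map (\<lambda>d. M - d) (pre n x)"
  by (rule nth_equalityI) (auto simp: reflect_def)

section \<open>Lexicographic order\<close>

lemma first_difference:
  assumes "x \<noteq> (y :: nat \<Rightarrow> nat)"
  obtains n where "\<forall>i<n. x i = y i" "x n \<noteq> y n"
proof -
  from assms obtain m where "x m \<noteq> y m" by (auto simp: fun_eq_iff)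
  then show ?thesis
    using that[of "LEAST n. x n \<noteq> y n"] LeastI[of "\<lambda>n. x n \<noteq> y n" m] not_less_Least by blast
qed

lemma lex_less_irrefl [simp]: "\<not> lex_less x x"
  by (simp add: lex_less_def)

lemma lex_less_trans:
  assumes "lex_less x y" "lex_less y z" shows "lex_less x z"
proof -
  obtain m where m: "\<forall>i<m. x i = y i" "x m < y m" using assms(1) by (auto simp: lex_less_def)
  obtain n where n: "\<forall>i<n. y i = z i" "y n < z n" using assms(2) by (auto simp: lex_less_def)
  show ?thesis unfolding lex_less_def
    using m n by (intro exI[of _ "min m n"]) (cases m n rule: linorder_cases; auto simp: min_def)
qed

lemma lex_linear: "lex_less x y \<or> x = y \<or> lex_less y x"
proof (cases "x = y")
  case False
  then obtain n where "\<forall>i<n. x i = y i" "x n \<noteq> y n" by (rule first_difference)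
  then show ?thesis unfolding lex_less_def by (metis linorder_neqE_nat)
qed simp

lemma lex_le_iff_not_less: "lex_le x y \<longleftrightarrow> \<not> lex_less y x"
  using lex_linear[of x y] lex_less_trans[of x y x] by (auto simp: lex_le_def)

lemma lex_less_iff_le_neq: "lex_less x y \<longleftrightarrow> lex_le x y \<and> x \<noteq> y"
  by (auto simp: lex_le_def)

lemma lex_le_refl [simp]: "lex_le x x"
  by (simp add: lex_le_def)

lemma lex_le_trans: "lex_le x y \<Longrightarrow> lex_le y z \<Longrightarrow> lex_le x z"
  using lex_less_trans by (auto simp: lex_le_def)

lemma lex_le_less_trans: "lex_le x y \<Longrightarrow> lex_less y z \<Longrightarrow> lex_less x z"
  using lex_less_trans by (auto simp: lex_le_def)

lemma lex_le_antisym: "lex_le x y \<Longrightarrow> lex_le y x \<Longrightarrow> x = y"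
  by (auto simp: lex_le_iff_not_less) (use lex_linear in blast)

lemma lex_less_reflectI:
  assumes "digits M y" "lex_less x y"
  shows "lex_less (reflect M y) (reflect M x)"
proof -
  obtain m where "\<forall>i<m. x i = y i" "x m < y m" using assms(2) by (auto simp: lex_less_def)
  then show ?thesis using digitsD[OF assms(1), of m]
    by (auto simp: lex_less_def reflect_def intro!: exI[of _ m])
qed

lemma lex_less_reflect_iff:
  "digits M x \<Longrightarrow> digits M y \<Longrightarrow> lex_less (reflect M x) (reflect M y) \<longleftrightarrow> lex_less y x"
  using lex_less_reflectI[of M x y] lex_less_reflectI[of M "reflect M y" "reflect M x"] by auto

lemma lex_less_reflect_swap:
  "digits M x \<Longrightarrow> digits M y \<Longrightarrow> lex_less (reflect M x) y \<longleftrightarrow> lex_less (reflect M y) x"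
  using lex_less_reflect_iff[of M x "reflect M y"] by auto

text \<open>A strict comparison is settled at the first differing index, so it is an open condition.
  This and its mirror image make unique expansions stable under changes far out and the subshift
  closed under limits.\<close>

lemma lex_less_pre_cong:
  "lex_less x y \<Longrightarrow> \<exists>n. \<forall>z. pre n z = pre n x \<longrightarrow> lex_less z y"
  unfolding lex_less_def pre_eq_iff by (metis lessI less_SucI)

lemma lex_less_pre_cong2:
  "lex_less y x \<Longrightarrow> \<exists>n. \<forall>z. pre n z = pre n x \<longrightarrow> lex_less y z"
  unfolding lex_less_def pre_eq_iff by (metis lessI less_SucI)

text \<open>Where \<open>x\<close> first drops below \<open>M\<close>, its shift has dropped one
  place earlier. This carries tail inequalities across digits \<open>M\<close>, after which
  uniqueness imposes no upper bound.\<close>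

lemma lex_le_shift_max:
  assumes "digits M x" "x 0 = M"
  shows "lex_le (shift 1 x) x"
proof (cases "x = (\<lambda>_. M)")
  case True
  then show ?thesis by (simp add: lex_le_def shift_def)
next
  case False
  then obtain n where n: "\<forall>i<n. x i = M" "x n \<noteq> M" by (rule first_difference)
  then obtain k where k: "n = Suc k" using assms(2) by (cases n) auto
  have "lex_less (shift 1 x) x" unfolding lex_less_def
    using n k digitsD[OF assms(1), of n] by (intro exI[of _ k]) (auto simp: shift_def)
  then show ?thesis by (simp add: lex_le_def)
qed

text \<open>Compactness of the full shift by Koenig's lemma: if a word begins infinitely many
  \<open>f n\<close>, one of its finitely many extensions by a digit does too.\<close>

lemma full_shift_accumulation:
  fixes f :: "nat \<Rightarrow> nat \<Rightarrow> nat"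
  assumes dig: "\<And>n. digits M (f n)"
  shows "\<exists>x. \<forall>m. infinite {n. pre m (f n) = pre m x}"
proof -
  define Q where "Q l \<longleftrightarrow> infinite {n. pre (length l) (f n) = l}" for l
  have ext: "\<exists>d. Q (l @ [d])" if "Q l" for l
  proof (rule ccontr)
    assume "\<not> ?thesis"
    then have "finite (\<Union>d\<in>{..M}. {n. pre (Suc (length l)) (f n) = l @ [d]})"
      by (auto simp: Q_def)
    moreover have "{n. pre (length l) (f n) = l} \<subseteq> (\<Union>d\<in>{..M}. {n. pre (Suc (length l)) (f n) = l @ [d]})"
      using digitsD[OF dig] by (auto simp: pre_def)
    ultimately show False using that finite_subset unfolding Q_def by blast
  qed
  have Q0: "Q []" by (simp add: Q_def)
  obtain g where g: "\<And>n. Q (g n) \<and> length (g n) = n" "\<And>n. \<exists>d. g (Suc n) = g n @ [d]"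
    using dependent_nat_choice[of "\<lambda>n l. Q l \<and> length l = n" "\<lambda>n l l'. \<exists>d. l' = l @ [d]"]
      Q0 ext by (metis length_0_conv length_append_singleton)
  have "pre n (\<lambda>i. g (Suc i) ! i) = g n" for n
  proof (induction n)
    case 0
    then show ?case using g(1)[of 0] by simp
  next
    case (Suc n)
    have "pre (Suc n) (\<lambda>i. g (Suc i) ! i) = g n @ [g (Suc n) ! n]"
      using Suc by (simp add: pre_def)
    also have "\<dots> = g (Suc n)" using g(2)[of n] g(1)[of n] by (metis nth_append_length)
    finally show ?case .
  qed
  then show ?thesis using g(1) unfolding Q_def
    by (intro exI[of _ "\<lambda>i. g (Suc i) ! i"]) (metis (no_types, lifting) Collect_cong)
qed

section \<open>Expansions in base q\<close>

definition psum :: "real \<Rightarrow> (nat \<Rightarrow> nat) \<Rightarrow> nat \<Rightarrow> real" where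
  "psum q x n = (\<Sum>i<n. real (x i) / q ^ Suc i)"

lemma psum_0 [simp]: "psum q x 0 = 0"
  by (simp add: psum_def)

lemma psum_Suc: "psum q x (Suc n) = psum q x n + real (x n) / q ^ Suc n"
  by (simp add: psum_def)

lemma psum_cong: "\<forall>i<n. x i = y i \<Longrightarrow> psum q x n = psum q y n"
  by (simp add: psum_def)

lemma psum_antimono:
  assumes "0 < p" "p \<le> q" shows "psum q x n \<le> psum p x n"
  unfolding psum_def
proof (rule sum_mono)
  fix i
  have "p ^ Suc i \<le> q ^ Suc i" "0 < p ^ Suc i" using assms by (auto intro!: power_mono simp del: power_Suc)
  then show "real (x i) / q ^ Suc i \<le> real (x i) / p ^ Suc i" using assms by (intro divide_left_mono) auto
qed

lemma sums_const_proj: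
  assumes "1 < (q::real)" shows "(\<lambda>i. c / q ^ Suc i) sums (c / (q - 1))"
proof -
  have "(\<lambda>i. (1 / q) ^ i) sums (1 / (1 - 1 / q))" using assms by (intro geometric_sums) auto
  then have "(\<lambda>i. (c / q) * (1 / q) ^ i) sums ((c / q) * (1 / (1 - 1 / q)))" by (rule sums_mult)
  moreover have "(c / q) * (1 / (1 - 1 / q)) = c / (q - 1)" using assms by (simp add: field_simps)
  moreover have "(\<lambda>i. (c / q) * (1 / q) ^ i) = (\<lambda>i. c / q ^ Suc i)" by (simp add: power_divide)
  ultimately show ?thesis by metis
qed

lemma proj_summable:
  assumes "1 < q" "digits M x" shows "summable (\<lambda>i. real (x i) / q ^ Suc i)"
proof (rule summable_comparison_test'[of "\<lambda>i. real M / q ^ Suc i" 0])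
  show "summable (\<lambda>i. real M / q ^ Suc i)" using sums_const_proj[OF assms(1)] by (rule sums_summable)
  show "norm (real (x i) / q ^ Suc i) \<le> real M / q ^ Suc i" for i
    using assms digitsD[OF assms(2), of i] by (simp add: divide_right_mono)
qed

lemma proj_const: "1 < q \<Longrightarrow> proj q (\<lambda>_. M) = real M / (q - 1)"
  unfolding proj_def by (rule sums_unique[symmetric, OF sums_const_proj])

lemma proj_nonneg: "1 < q \<Longrightarrow> digits M x \<Longrightarrow> 0 \<le> proj q x"
  unfolding proj_def by (rule suminf_nonneg[OF proj_summable]) auto

lemma proj_split:
  assumes "1 < q" "digits M x"
  shows "proj q x = psum q x n + proj q (shift n x) / q ^ n"
proof -
  have "proj q x = psum q x n + (\<Sum>i. real (x (i + n)) / q ^ Suc (i + n))"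
    unfolding proj_def psum_def using suminf_split_initial_segment[OF proj_summable[OF assms], of n] by simp
  also have "(\<Sum>i. real (x (i + n)) / q ^ Suc (i + n)) = (\<Sum>i. real (shift n x i) / q ^ Suc i / q ^ n)"
    using assms by (simp add: shift_def power_add mult.assoc)
  also have "\<dots> = proj q (shift n x) / q ^ n"
    unfolding proj_def using proj_summable[OF assms(1) digits_shift[OF assms(2)]] by (rule suminf_divide)
  finally show ?thesis .
qed

lemma proj_step:
  assumes "1 < q" "digits M x"
  shows "proj q x = psum q x n + real (x n) / q ^ Suc n + proj q (shift (Suc n) x) / q ^ Suc n"
  using proj_split[OF assms, of "Suc n"] by (simp add: psum_Suc)

lemma proj_reflect:
  assumes "1 < q" "digits M x"
  shows "proj q (reflect M x) = real M / (q - 1) - proj q x"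
proof -
  have "proj q (reflect M x) = (\<Sum>i. real M / q ^ Suc i - real (x i) / q ^ Suc i)"
    unfolding proj_def reflect_def using digitsD[OF assms(2)]
    by (intro suminf_cong) (simp add: of_nat_diff diff_divide_distrib)
  also have "\<dots> = (\<Sum>i. real M / q ^ Suc i) - proj q x"
    unfolding proj_def using sums_summable[OF sums_const_proj[OF assms(1)]] proj_summable[OF assms]
    by (rule suminf_diff[symmetric])
  finally show ?thesis using sums_unique[OF sums_const_proj[OF assms(1), of "real M"]] by simp
qed

lemma proj_le: "1 < q \<Longrightarrow> digits M x \<Longrightarrow> proj q x \<le> real M / (q - 1)"
  using proj_reflect[of q M x] proj_nonneg[of q M "reflect M x"] by simp

lemma psum_le_proj: "1 < q \<Longrightarrow> digits M x \<Longrightarrow> psum q x n \<le> proj q x"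
  using proj_split[of q M x n] proj_nonneg[OF _ digits_shift, of q M x n] by simp

lemma psum_less_proj:
  assumes "1 < q" "digits M x" "infinite {i. x i \<noteq> 0}"
  shows "psum q x n < proj q x"
proof -
  obtain m where m: "m \<ge> n" "x m \<noteq> 0" using assms(3) by (auto simp: infinite_nat_iff_unbounded_le)
  have "psum q x n \<le> psum q x m" unfolding psum_def using m assms by (intro sum_mono2) auto
  also have "\<dots> < psum q x (Suc m)" using m assms by (simp add: psum_Suc)
  also have "\<dots> \<le> proj q x" using assms psum_le_proj by blast
  finally show ?thesis .
qed

lemma proj_close:
  assumes "1 < q" "digits M x" "digits M y" "pre n x = pre n y"
  shows "\<bar>proj q x - proj q y\<bar> \<le> real M / (q - 1) / q ^ n"
proof -
  have "psum q x n = psum q y n" using assms(4) by (auto intro: psum_cong dest: pre_eqD)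
  then have "proj q x - proj q y = (proj q (shift n x) - proj q (shift n y)) / q ^ n"
    using proj_split[OF assms(1,2), of n] proj_split[OF assms(1,3), of n] by (simp add: diff_divide_distrib)
  moreover have "\<bar>proj q (shift n x) - proj q (shift n y)\<bar> \<le> real M / (q - 1)"
    using proj_nonneg[OF assms(1) digits_shift[OF assms(2)], of n] proj_le[OF assms(1) digits_shift[OF assms(2)], of n]
      proj_nonneg[OF assms(1) digits_shift[OF assms(3)], of n] proj_le[OF assms(1) digits_shift[OF assms(3)], of n]
    by linarith
  then have "\<bar>proj q (shift n x) - proj q (shift n y)\<bar> / q ^ n \<le> real M / (q - 1) / q ^ n"
    using assms(1) by (intro divide_right_mono) auto
  ultimately show ?thesis using assms(1) by simp
qed

text \<open>The quasi-greedy algorithm: each step takes the largest digit that leaves a positive remainder.\<close>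

definition qg_digit :: "nat \<Rightarrow> real \<Rightarrow> nat" where
  "qg_digit M t = min M (nat (\<lceil>t\<rceil> - 1))"

primrec qg_rem :: "nat \<Rightarrow> real \<Rightarrow> real \<Rightarrow> nat \<Rightarrow> real" where
  "qg_rem M q x 0 = x"
| "qg_rem M q x (Suc n) = q * qg_rem M q x n - real (qg_digit M (q * qg_rem M q x n))"

lemma qg_digit:
  assumes "0 < t"
  shows "qg_digit M t \<le> M" "real (qg_digit M t) < t" "qg_digit M t < M \<Longrightarrow> t \<le> real (qg_digit M t) + 1"
proof -
  define k where "k = nat (\<lceil>t\<rceil> - 1)"
  have "\<lceil>t\<rceil> \<ge> 1" using assms by linarith
  then have "real k = of_int \<lceil>t\<rceil> - 1" by (simp add: k_def)
  then have *: "real k < t" "t \<le> real k + 1" by linarith+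
  have k: "qg_digit M t = min M k" by (simp add: qg_digit_def k_def)
  show "qg_digit M t \<le> M" by (simp add: k)
  show "real (qg_digit M t) < t" using * by (simp add: k min_def)
  show "qg_digit M t < M \<Longrightarrow> t \<le> real (qg_digit M t) + 1" using * by (simp add: k min_def split: if_splits)
qed

text \<open>The remainders stay in \<open>(0, M / (q - 1)]\<close>: positivity gives partial sums
  below \<open>x\<close>, boundedness gives convergence. The last conjunct states maximality
  numerically: raising a digit below \<open>M\<close> already reaches \<open>x\<close>.\<close>

lemma quasi_greedy_expansion_exists:
  assumes "1 < q" "q \<le> real M + 1" "0 < x" "x \<le> real M / (q - 1)"
  shows "\<exists>a. digits M a \<and> proj q a = x \<and> (\<forall>n. psum q a n < x)
    \<and> (\<forall>n. a n < M \<longrightarrow> x \<le> psum q a n + (real (a n) + 1) / q ^ Suc n)"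
proof -
  define r where "r = qg_rem M q x"
  define a where "a n = qg_digit M (q * r n)" for n
  have rS: "r (Suc n) = q * r n - real (a n)" for n by (simp add: r_def a_def)
  have r0: "r 0 = x" by (simp add: r_def)
  have one: "1 \<le> real M / (q - 1)" using assms by simp
  have rb: "0 < r n \<and> r n \<le> real M / (q - 1)" for n
  proof (induction n)
    case 0
    then show ?case using assms r0 by simp
  next
    case (Suc n)
    have t: "0 < q * r n" using Suc assms by simp
    \<comment> \<open>A digit below \<open>M\<close> leaves a remainder of at most 1, which is
      within the bound because \<open>q \<le> M + 1\<close>. For the digit \<open>M\<close>, the
      bound is the fixed point of \<open>t\<close> mapped to \<open>q t - M\<close>.\<close>
    have "r (Suc n) \<le> real M / (q - 1)"
    proof (cases "a n < M")
      case True
      then show ?thesis using qg_digit(3)[OF t, of M] rS[of n] one by (simp add: a_def)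
    next
      case False
      then have "a n = M" using qg_digit(1)[OF t, of M] by (simp add: a_def)
      moreover have "q * r n \<le> q * (real M / (q - 1))" using Suc assms by (intro mult_left_mono) auto
      moreover have "q * (real M / (q - 1)) - real M = real M / (q - 1)" using assms(1) by (simp add: field_simps)
      ultimately show ?thesis using rS[of n] by simp
    qed
    then show ?case using qg_digit(2)[OF t, of M] rS[of n] by (simp add: a_def)
  qed
  have t: "0 < q * r n" for n using rb assms by simp
  have dig: "digits M a" using qg_digit(1)[OF t] by (simp add: digits_def a_def)
  have ps: "psum q a n = x - r n / q ^ n" for n
  proof (induction n)
    case (Suc n)
    have "r n / q ^ n = (r (Suc n) + real (a n)) / q ^ Suc n" using rS[of n] assms(1) by simp
    then show ?case using Suc by (simp add: psum_Suc add_divide_distrib)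
  qed (simp add: r0)
  have lt: "psum q a n < x" for n using ps[of n] rb[of n] assms by simp
  have "(\<lambda>n. r n / q ^ n) \<longlonglongrightarrow> 0"
  proof (rule tendsto_sandwich[OF _ _ tendsto_const])
    show "\<forall>\<^sub>F n in sequentially. 0 \<le> r n / q ^ n" using rb assms by (intro always_eventually allI) (simp add: less_imp_le)
    show "\<forall>\<^sub>F n in sequentially. r n / q ^ n \<le> (real M / (q - 1)) * (1 / q) ^ n"
      proof (intro always_eventually allI)
      fix n
      have "r n / q ^ n \<le> real M / (q - 1) / q ^ n" using rb assms by (intro divide_right_mono) auto
      then show "r n / q ^ n \<le> (real M / (q - 1)) * (1 / q) ^ n" by (simp add: power_divide)
    qed
    have "(\<lambda>n. (1 / q) ^ n) \<longlonglongrightarrow> 0" using assms by (intro LIMSEQ_power_zero) auto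
    from tendsto_mult_right_zero[OF this] show "(\<lambda>n. (real M / (q - 1)) * (1 / q) ^ n) \<longlonglongrightarrow> 0" .
  qed
  then have "(\<lambda>n. psum q a n) \<longlonglongrightarrow> x" unfolding ps using tendsto_diff[OF tendsto_const[of x]] by fastforce
  moreover have "(\<lambda>n. psum q a n) \<longlonglongrightarrow> proj q a"
    unfolding psum_def proj_def using summable_LIMSEQ[OF proj_summable[OF assms(1) dig]] .
  ultimately have pr: "proj q a = x" using LIMSEQ_unique by blast
  have "x \<le> psum q a n + (real (a n) + 1) / q ^ Suc n" if "a n < M" for n
  proof -
    have "q * r n \<le> real (a n) + 1" using qg_digit(3)[OF t, of M] that by (simp add: a_def)
    then have "r n \<le> (real (a n) + 1) / q" using assms by (simp add: field_simps)
    then have "r n / q ^ n \<le> (real (a n) + 1) / q / q ^ n" using assms by (intro divide_right_mono) auto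
    then show ?thesis unfolding ps by simp
  qed
  then show ?thesis using dig pr lt by blast
qed

lemma expansion_exists:
  assumes "1 < q" "q \<le> real M + 1" "0 \<le> x" "x \<le> real M / (q - 1)"
  shows "\<exists>a. digits M a \<and> proj q a = x"
proof (cases "x = 0")
  case True
  then show ?thesis by (intro exI[of _ "\<lambda>_. 0"]) (simp add: proj_def digits_def)
next
  case False
  then show ?thesis using quasi_greedy_expansion_exists[OF assms(1,2), of x] assms by auto
qed

text \<open>The output of the algorithm is identified with the sequence picked out by
  \<open>THE\<close>. From here on its two numerical properties stand in for lexicographic
  maximality: partial sums are below 1, and raising a digit below \<open>M\<close> reaches
  1.\<close>

lemma quasi_greedy_properties:
  assumes "1 < q" "q \<le> real M + 1"
  shows digits_quasi_greedy: "digits M (quasi_greedy M q)"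
    and proj_quasi_greedy: "proj q (quasi_greedy M q) = 1"
    and psum_quasi_greedy: "psum q (quasi_greedy M q) n < 1"
    and quasi_greedy_maximal: "quasi_greedy M q n < M \<Longrightarrow>
      1 \<le> psum q (quasi_greedy M q) n + (real (quasi_greedy M q n) + 1) / q ^ Suc n"
proof -
  have "1 \<le> real M / (q - 1)" using assms by simp
  then obtain a where a: "digits M a" "proj q a = 1" "\<And>n. psum q a n < 1"
    "\<And>n. a n < M \<Longrightarrow> 1 \<le> psum q a n + (real (a n) + 1) / q ^ Suc n"
    using quasi_greedy_expansion_exists[OF assms, of 1] by auto
  have inf: "infinite {i. a i \<noteq> 0}"
  proof
    assume "finite {i. a i \<noteq> 0}"
    then obtain n where n: "\<And>i. i \<ge> n \<Longrightarrow> a i = 0"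
      by (metis (mono_tags, lifting) finite_nat_set_iff_bounded mem_Collect_eq not_less)
    then have "shift n a = (\<lambda>_. 0)" by (auto simp: shift_def)
    then have "proj q (shift n a) = 0" by (simp add: proj_def)
    then show False using proj_split[OF assms(1) a(1), of n] a(2) a(3)[of n] by simp
  qed
  have max: "lex_le b a" if b: "digits M b" "proj q b = 1" "infinite {i. b i \<noteq> 0}" for b
  proof (rule ccontr)
    assume "\<not> lex_le b a"
    then obtain n where n: "\<forall>i<n. a i = b i" "a n < b n" by (auto simp: lex_le_iff_not_less lex_less_def)
    have "1 \<le> psum q a n + (real (a n) + 1) / q ^ Suc n" using a(4) n digitsD[OF b(1), of n] by simp
    also have "\<dots> \<le> psum q b (Suc n)"
      using psum_cong[of n a b q] n assms by (simp add: psum_Suc divide_right_mono)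
    also have "\<dots> < 1" using psum_less_proj[OF assms(1) b(1) b(3)] b(2) by simp
    finally show False by simp
  qed
  have "quasi_greedy M q = a" unfolding quasi_greedy_def
    using a(1,2) inf max by (intro the_equality) (auto intro: lex_le_antisym)
  then show "digits M (quasi_greedy M q)" "proj q (quasi_greedy M q) = 1" "psum q (quasi_greedy M q) n < 1"
    "quasi_greedy M q n < M \<Longrightarrow>
      1 \<le> psum q (quasi_greedy M q) n + (real (quasi_greedy M q n) + 1) / q ^ Suc n"
    using a by auto
qed

text \<open>If \<alpha>(q) first fell below \<alpha>(p) at \<open>n\<close>, raising its digit there
  would reach 1 in base \<open>q\<close>. The partial sum of \<alpha>(p) up to \<open>n\<close>
  would then reach 1 in base \<open>q\<close>, hence in the smaller base \<open>p\<close>, where it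
  must be below 1.\<close>

lemma quasi_greedy_mono:
  assumes "1 < p" "p \<le> q" "q \<le> real M + 1"
  shows "lex_le (quasi_greedy M p) (quasi_greedy M q)"
proof (rule ccontr)
  let ?a = "quasi_greedy M q" and ?b = "quasi_greedy M p"
  have q: "1 < q" and p: "p \<le> real M + 1" using assms by auto
  assume "\<not> ?thesis"
  then obtain n where n: "\<forall>i<n. ?a i = ?b i" "?a n < ?b n" by (auto simp: lex_le_iff_not_less lex_less_def)
  have "1 \<le> psum q ?a n + (real (?a n) + 1) / q ^ Suc n"
    using quasi_greedy_maximal[OF q assms(3)] n digitsD[OF digits_quasi_greedy[OF assms(1) p], of n] by simp
  also have "\<dots> \<le> psum q ?b (Suc n)"
    using psum_cong[of n ?a ?b q] n q by (simp add: psum_Suc divide_right_mono)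
  also have "\<dots> \<le> psum p ?b (Suc n)" using assms by (intro psum_antimono) auto
  also have "\<dots> < 1" using psum_quasi_greedy[OF assms(1) p] by blast
  finally show False by simp
qed

text \<open>The partial sum of \<alpha>(q) over \<open>N\<close> digits is below 1 in base
  \<open>q\<close>, and by continuity still in a slightly smaller base \<open>p\<close>. An earlier
  drop of \<alpha>(p) below \<alpha>(q) would force that sum to be at least 1.\<close>

lemma quasi_greedy_left_continuous:
  assumes "1 < q" "q \<le> real M + 1"
  shows "\<exists>p. 1 < p \<and> p < q \<and> pre N (quasi_greedy M p) = pre N (quasi_greedy M q)"
proof -
  let ?a = "quasi_greedy M q"
  have "((\<lambda>p. psum p ?a N) \<longlongrightarrow> psum q ?a N) (at_left q)"
    unfolding psum_def using assms by (intro tendsto_intros) auto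
  then have "\<forall>\<^sub>F p in at_left q. psum p ?a N < 1"
    using psum_quasi_greedy[OF assms] by (rule order_tendstoD)
  then have "\<forall>\<^sub>F p in at_left q. psum p ?a N < 1 \<and> p \<in> {1<..<q}"
    using eventually_at_left_real[OF assms(1)] by (rule eventually_conj)
  then obtain p where p: "psum p ?a N < 1" "1 < p" "p < q"
    using eventually_happens'[OF trivial_limit_at_left_real] by fastforce
  have pM: "p \<le> real M + 1" using p assms by simp
  let ?b = "quasi_greedy M p"
  have "pre N ?b = pre N ?a"
  proof (rule ccontr)
    assume ne: "pre N ?b \<noteq> pre N ?a"
    then have "?b \<noteq> ?a" by auto
    then have "lex_less ?b ?a" using quasi_greedy_mono[of p q M] p assms by (auto simp: lex_le_def)
    then obtain n where n: "\<forall>i<n. ?b i = ?a i" "?b n < ?a n" by (auto simp: lex_less_def)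
    have nN: "n < N" using ne n unfolding pre_eq_iff by (meson linorder_not_le order_less_le_trans)
    have "1 \<le> psum p ?b n + (real (?b n) + 1) / p ^ Suc n"
      using quasi_greedy_maximal[OF p(2) pM] n digitsD[OF digits_quasi_greedy[OF assms], of n] by simp
    also have "\<dots> \<le> psum p ?a (Suc n)"
      using psum_cong[of n ?b ?a p] n p by (simp add: psum_Suc divide_right_mono)
    also have "\<dots> \<le> psum p ?a N" unfolding psum_def using nN p by (intro sum_mono2) auto
    finally show False using p by simp
  qed
  then show ?thesis using p by blast
qed

lemma quasi_greedy_top:
  assumes "M \<ge> 1" shows "quasi_greedy M (real M + 1) = (\<lambda>_. M)"
proof (rule ccontr)
  let ?q = "real M + 1" let ?a = "quasi_greedy M ?q"
  have q: "1 < ?q" using assms by simp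
  assume "?a \<noteq> (\<lambda>_. M)"
  then obtain n where n: "\<forall>i<n. ?a i = M" "?a n \<noteq> M" by (rule first_difference)
  then have less: "?a n < M" using digitsD[OF digits_quasi_greedy[OF q order_refl], of n] by simp
  have "1 \<le> psum ?q ?a n + (real (?a n) + 1) / ?q ^ Suc n"
    using quasi_greedy_maximal[OF q order_refl less] .
  also have "\<dots> \<le> psum ?q (\<lambda>_. M) (Suc n)"
    using psum_cong[of n ?a "\<lambda>_. M" ?q] n less by (simp add: psum_Suc divide_right_mono)
  also have "\<dots> < proj ?q (\<lambda>_. M)"
    using assms by (intro psum_less_proj[OF q, of M]) (auto simp: digits_def)
  also have "\<dots> = 1" using proj_const[OF q] assms by simp
  finally show False by simp
qed

section \<open>Unique expansions\<close>

lemma pre_shift_cong: "pre (k + n) x = pre (k + n) y \<Longrightarrow> pre n (shift k x) = pre n (shift k y)"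
  by (simp add: pre_add) 

lemma lex_le_shift_zero:
  assumes "digits M x" "x 0 = 0"
  shows "lex_le x (shift 1 x)"
proof -
  have "lex_le (reflect M (shift 1 x)) (reflect M x)"
    using lex_le_shift_max[of M "reflect M x"] assms by (simp add: shift_reflect) (simp add: reflect_def)
  then show ?thesis using lex_less_reflect_iff[OF assms(1) digits_shift[OF assms(1), of 1]]
    by (simp add: lex_le_iff_not_less)
qed

section \<open>The symmetric subshift and the values of its sequences\<close>

locale expansion_base =
  fixes M :: nat and q :: real
  assumes q_gt_1: "1 < q" and q_le: "q \<le> real M + 1"
begin

abbreviation \<alpha> :: "nat \<Rightarrow> nat" where "\<alpha> \<equiv> quasi_greedy M q"

lemma digits_\<alpha> [simp]: "digits M \<alpha>"
  using digits_quasi_greedy[OF q_gt_1 q_le] .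

text \<open>Reflection reverses the order, so the lower bound on tails becomes an upper bound on
  reflected tails, and one-sided arguments apply twice.\<close>

lemma Vq_iff: "x \<in> Vq M q \<longleftrightarrow> digits M x \<and>
  (\<forall>n. lex_le (shift n x) \<alpha> \<and> lex_le (shift n (reflect M x)) \<alpha>)"
  using lex_less_reflect_swap[OF digits_shift[of M x] digits_\<alpha>] lex_less_reflect_swap[OF digits_\<alpha>]
  unfolding Vq_def lex_le_iff_not_less shift_reflect
  by (smt (verit) digits_\<alpha> digits_reflect digits_shift lex_less_reflect_iff mem_Collect_eq reflect_reflect)

lemma digits_Vq: "x \<in> Vq M q \<Longrightarrow> digits M x"
  by (simp add: Vq_iff)

lemma shift_Vq: "x \<in> Vq M q \<Longrightarrow> shift n x \<in> Vq M q"
  by (simp add: Vq_iff digits_shift shift_reflect[symmetric])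

lemma reflect_Vq: "x \<in> Vq M q \<Longrightarrow> reflect M x \<in> Vq M q"
  by (simp add: Vq_iff)

text \<open>A violated inequality is strict, hence visible in finitely many digits, which some
  member of the subshift shares.\<close>

lemma Vq_closed:
  assumes "digits M x" "\<And>n. \<exists>v\<in>Vq M q. pre n v = pre n x"
  shows "x \<in> Vq M q"
proof -
  have *: "lex_le (shift n x) \<alpha>" if h: "\<And>n. \<exists>v. (\<forall>m. lex_le (shift m v) \<alpha>) \<and> pre n v = pre n x" for n x
  proof (rule ccontr)
    assume "\<not> ?thesis"
    then have "lex_less \<alpha> (shift n x)" by (simp add: lex_le_iff_not_less)
    then obtain N where N: "\<And>z. pre N z = pre N (shift n x) \<Longrightarrow> lex_less \<alpha> z"
      using lex_less_pre_cong2 by blast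
    obtain v where v: "\<And>m. lex_le (shift m v) \<alpha>" "pre (n + N) v = pre (n + N) x" using h by blast
    show False using v(1)[of n] N[OF pre_shift_cong[OF v(2)]] by (simp add: lex_le_iff_not_less)
  qed
  have "lex_le (shift n x) \<alpha>" for n
    by (rule *) (use assms(2) in \<open>force simp: Vq_iff\<close>)
  moreover have "lex_le (shift n (reflect M x)) \<alpha>" for n
  proof (rule *)
    fix n
    obtain v where "v \<in> Vq M q" "pre n v = pre n x" using assms(2) by blast
    then show "\<exists>v. (\<forall>m. lex_le (shift m v) \<alpha>) \<and> pre n v = pre n (reflect M x)"
      by (intro exI[of _ "reflect M v"]) (simp add: Vq_iff pre_reflect)
  qed
  ultimately show ?thesis using assms(1) by (simp add: Vq_iff)
qed

text \<open>A bound \<open>1 + K\<close> on the value of all such sequences improves to \<open>1 + K / q\<close> by comparison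
  with \<open>\<alpha>\<close> at the first difference.\<close>

lemma proj_le_one:
  assumes "digits M z" "\<And>n. lex_le (shift n z) \<alpha>"
  shows "proj q z \<le> 1"
proof -
  let ?K = "real M / (q - 1)"
  have "\<forall>z. digits M z \<and> (\<forall>n. lex_le (shift n z) \<alpha>) \<longrightarrow> proj q z \<le> 1 + ?K / q ^ k" for k
  proof (induction k)
    case 0
    then show ?case using proj_le[OF q_gt_1] by (simp add: add_increasing)
  next
    case (Suc k)
    show ?case
    proof (intro allI impI)
      fix z assume z: "digits M z \<and> (\<forall>n. lex_le (shift n z) \<alpha>)"
      have K: "0 \<le> ?K / q ^ k" using q_gt_1 by simp
      show "proj q z \<le> 1 + ?K / q ^ Suc k"
      proof (cases "z = \<alpha>")
        case True
        then show ?thesis using proj_quasi_greedy[OF q_gt_1 q_le] q_gt_1 by simp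
      next
        case False
        then have "lex_less z \<alpha>" using z[THEN conjunct2, rule_format, of 0] by (simp add: lex_less_iff_le_neq)
        then obtain n where n: "\<forall>i<n. z i = \<alpha> i" "z n < \<alpha> n" by (auto simp: lex_less_def)
        have "proj q (shift (Suc n) z) \<le> 1 + ?K / q ^ k" using Suc z digits_shift by simp
        then have "real (z n) + proj q (shift (Suc n) z) \<le> real (\<alpha> n) + ?K / q ^ k" using n by linarith
        then have "(real (z n) + proj q (shift (Suc n) z)) / q ^ Suc n \<le> (real (\<alpha> n) + ?K / q ^ k) / q ^ Suc n"
          using q_gt_1 by (intro divide_right_mono) auto
        moreover have "psum q z n = psum q \<alpha> n" using n by (auto intro: psum_cong)
        ultimately have "proj q z \<le> psum q \<alpha> (Suc n) + ?K / q ^ k / q ^ Suc n"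
          using proj_step[OF q_gt_1 conjunct1[OF z], of n] by (simp add: psum_Suc add_divide_distrib)
        moreover have "psum q \<alpha> (Suc n) \<le> 1" using psum_quasi_greedy[OF q_gt_1 q_le] by (simp add: less_imp_le)
        moreover have "?K / q ^ k / q ^ Suc n \<le> ?K / q ^ k / q ^ 1"
          using K q_gt_1 by (intro divide_left_mono power_increasing) auto
        moreover have "?K / q ^ k / q ^ 1 = ?K / q ^ Suc k" by (simp add: ac_simps)
        ultimately show ?thesis by linarith
      qed
    qed
  qed
  then have "proj q z \<le> 1 + ?K / q ^ k" for k using assms by blast
  moreover have "(\<lambda>k. 1 + ?K / q ^ k) \<longlonglongrightarrow> 1"
  proof -
    have "(\<lambda>n. (1 / q) ^ n) \<longlonglongrightarrow> 0" using q_gt_1 by (intro LIMSEQ_power_zero) auto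
    from tendsto_add[OF tendsto_const[of 1] tendsto_mult_right_zero[OF this, of ?K]]
    show ?thesis by (simp add: power_divide)
  qed
  ultimately show ?thesis by (intro LIMSEQ_le_const) auto
qed

text \<open>At the first difference from \<open>\<alpha>\<close> the digit is smaller by at least 1,
  and the tail is worth at most 1. So the value is at most a partial sum of \<open>\<alpha>\<close>,
  and those are strictly below 1.\<close>

lemma proj_less_one:
  assumes "digits M z" "\<And>n. lex_le (shift n z) \<alpha>" "z \<noteq> \<alpha>"
  shows "proj q z < 1"
proof -
  have "lex_less z \<alpha>" using assms(2)[of 0] assms(3) by (simp add: lex_less_iff_le_neq)
  then obtain n where n: "\<forall>i<n. z i = \<alpha> i" "z n < \<alpha> n" by (auto simp: lex_less_def)
  have "proj q (shift (Suc n) z) \<le> 1" using assms by (intro proj_le_one digits_shift) auto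
  then have "(real (z n) + proj q (shift (Suc n) z)) / q ^ Suc n \<le> real (\<alpha> n) / q ^ Suc n"
    using q_gt_1 n by (intro divide_right_mono) auto
  moreover have "psum q z n = psum q \<alpha> n" using n by (auto intro: psum_cong)
  ultimately have "proj q z \<le> psum q \<alpha> (Suc n)"
    using proj_step[OF q_gt_1 assms(1), of n] by (simp add: psum_Suc add_divide_distrib)
  then show ?thesis using psum_quasi_greedy[OF q_gt_1 q_le, of "Suc n"] by simp
qed

text \<open>The lexicographic criterion for unique expansions: a tail is constrained only after a
  digit that could be raised, a reflected tail only after a digit that could be lowered.
  \<open>univoque_eq\<close> proves the equivalence.\<close>

definition uniq :: "(nat \<Rightarrow> nat) \<Rightarrow> bool" where
  "uniq x \<longleftrightarrow> digits M x \<and> (\<forall>n. x n < M \<longrightarrow> lex_less (shift (Suc n) x) \<alpha>)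
     \<and> (\<forall>n. 0 < x n \<longrightarrow> lex_less (shift (Suc n) (reflect M x)) \<alpha>)"

lemma uniq_reflect:
  assumes "uniq x" shows "uniq (reflect M x)"
proof -
  have d: "digits M x" using assms by (simp add: uniq_def)
  have "reflect M x n < M \<longleftrightarrow> 0 < x n" "0 < reflect M x n \<longleftrightarrow> x n < M" for n
    using digitsD[OF d, of n] by (auto simp: reflect_def)
  then show ?thesis using assms d by (simp add: uniq_def)
qed

text \<open>Once one digit below \<open>M\<close> has occurred, the bound never lapses: after a
  digit below \<open>M\<close> it is the criterion itself, and after a digit \<open>M\<close> the
  next tail is no larger than the previous one.\<close>

lemma uniq_tail_less:
  assumes "uniq x" "x n < M" "n \<le> m"
  shows "lex_less (shift (Suc m) x) \<alpha>"
  using assms(3)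
proof (induction m rule: dec_induct)
  case base
  then show ?case using assms by (simp add: uniq_def)
next
  case (step m)
  show ?case
  proof (cases "x (Suc m) < M")
    case True
    then show ?thesis using assms(1) by (simp add: uniq_def)
  next
    case False
    have d: "digits M x" using assms by (simp add: uniq_def)
    then have "x (Suc m) = M" using False digitsD[OF d, of "Suc m"] by simp
    then have "lex_le (shift (Suc (Suc m)) x) (shift (Suc m) x)"
      using lex_le_shift_max[OF digits_shift[OF d], of "Suc m"] by (simp add: shift_def)
    then show ?thesis using step lex_le_less_trans by blast
  qed
qed

text \<open>Where \<open>y\<close> first exceeds \<open>x\<close> it gains a full unit, while the
  remaining tail of \<open>x\<close> is worth less than 1 and that of \<open>y\<close> at least 0.
  Reflection deals with smaller \<open>y\<close>.\<close>

lemma uniq_not_less: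
  assumes x: "uniq x" and y: "digits M y" and eq: "proj q y = proj q x" and less: "lex_less x y"
  shows False
proof -
  obtain n where n: "\<forall>i<n. x i = y i" "x n < y n" using less by (auto simp: lex_less_def)
  have d: "digits M x" using x by (simp add: uniq_def)
  have xM: "x n < M" using n digitsD[OF y, of n] by simp
  have t: "lex_less (shift k (shift (Suc n) x)) \<alpha>" for k
    using uniq_tail_less[OF x xM, of "k + n"] by simp
  have "proj q (shift (Suc n) x) < 1"
    using t[of 0] t by (intro proj_less_one digits_shift d) (auto simp: lex_le_def)
  moreover have "psum q x n = psum q y n" using n by (auto intro: psum_cong)
  moreover have "0 \<le> proj q (shift (Suc n) y)" using proj_nonneg[OF q_gt_1 digits_shift[OF y]] .
  ultimately have "(real (x n) + proj q (shift (Suc n) x)) / q ^ Suc n < (real (y n) + proj q (shift (Suc n) y)) / q ^ Suc n"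
    using n q_gt_1 by (intro divide_strict_right_mono) auto
  then show False
    using proj_step[OF q_gt_1 d, of n] proj_step[OF q_gt_1 y, of n] eq \<open>psum q x n = psum q y n\<close>
    by (simp add: add_divide_distrib)
qed

lemma uniq_imp_unique:
  assumes "uniq x" "digits M y" "proj q y = proj q x"
  shows "y = x"
proof -
  have d: "digits M x" using assms by (simp add: uniq_def)
  have "\<not> lex_less (reflect M x) (reflect M y)"
    using uniq_not_less[OF uniq_reflect[OF assms(1)], of "reflect M y"] assms d q_gt_1 by (auto simp: proj_reflect)
  then show ?thesis using uniq_not_less[OF assms] lex_linear[of x y] lex_less_reflect_iff[OF d assms(2)] by blast
qed

section \<open>Necessity of the lexicographic criterion\<close>

lemma proj_ge_one:
  assumes "digits M y" "lex_le \<alpha> y"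
  shows "1 \<le> proj q y"
proof (cases "\<alpha> = y")
  case True
  then show ?thesis using proj_quasi_greedy[OF q_gt_1 q_le] by simp
next
  case False
  then obtain n where n: "\<forall>i<n. \<alpha> i = y i" "\<alpha> n < y n" using assms(2) by (auto simp: lex_le_def lex_less_def)
  have "1 \<le> psum q \<alpha> n + (real (\<alpha> n) + 1) / q ^ Suc n"
    using quasi_greedy_maximal[OF q_gt_1 q_le] n digitsD[OF assms(1), of n] by simp
  also have "\<dots> \<le> psum q y (Suc n)"
    using psum_cong[of n \<alpha> y q] n q_gt_1 by (simp add: psum_Suc divide_right_mono)
  also have "\<dots> \<le> proj q y" using psum_le_proj[OF q_gt_1 assms(1)] .
  finally show ?thesis .
qed

text \<open>Otherwise the tail is worth at least 1. The digit \<open>x n\<close> can then be raised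
  by 1 and the tail replaced by an expansion of its value minus 1, which yields a second
  expansion.\<close>

lemma unique_imp_tail_less:
  assumes d: "digits M x" and u: "\<And>y. digits M y \<Longrightarrow> proj q y = proj q x \<Longrightarrow> y = x" and n: "x n < M"
  shows "lex_less (shift (Suc n) x) \<alpha>"
proof (rule ccontr)
  assume "\<not> ?thesis"
  then have "1 \<le> proj q (shift (Suc n) x)" using d by (intro proj_ge_one digits_shift) (auto simp: lex_le_iff_not_less)
  moreover have "proj q (shift (Suc n) x) - 1 \<le> real M / (q - 1)" using proj_le[OF q_gt_1 digits_shift[OF d], of "Suc n"] by simp
  ultimately obtain z where z: "digits M z" "proj q z = proj q (shift (Suc n) x) - 1"
    using expansion_exists[OF q_gt_1 q_le, of "proj q (shift (Suc n) x) - 1"] by auto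
  define y where "y = cat (pre n x @ [Suc (x n)]) z"
  have y: "digits M y" using z n set_pre[OF d, of n] by (simp add: y_def digits_cat)
  have y1: "shift (Suc n) y = z" using shift_cat_length[of "pre n x @ [Suc (x n)]" z] by (simp add: y_def)
  have y2: "y n = Suc (x n)" "\<forall>i<n. y i = x i" by (auto simp: y_def cat_def nth_append)
  have "proj q y = proj q x"
    using proj_step[OF q_gt_1 d, of n] proj_step[OF q_gt_1 y, of n] psum_cong[OF y2(2), of q] z y1 y2(1)
    by (simp add: diff_divide_distrib add_divide_distrib)
  with u[OF y] y2 show False by simp
qed

lemma unique_imp_uniq:
  assumes d: "digits M x" and u: "\<And>y. digits M y \<Longrightarrow> proj q y = proj q x \<Longrightarrow> y = x"
  shows "uniq x"
proof -
  have u': "y = reflect M x" if "digits M y" "proj q y = proj q (reflect M x)" for y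
  proof -
    have "reflect M y = x" using u[of "reflect M y"] that d q_gt_1 by (simp add: proj_reflect)
    then show ?thesis using that by auto
  qed
  have "lex_less (shift (Suc n) (reflect M x)) \<alpha>" if "0 < x n" for n
    using that digitsD[OF d, of n] by (intro unique_imp_tail_less[OF digits_reflect u']) (auto simp: reflect_def)
  then show ?thesis unfolding uniq_def using d unique_imp_tail_less[OF d u] by simp
qed

lemma univoque_eq: "univoque M q = proj q ` {x. uniq x}"
proof (intro equalityI subsetI)
  fix t assume "t \<in> univoque M q"
  then obtain s where "digits M s" "proj q s = t" "\<And>y. digits M y \<Longrightarrow> proj q y = t \<Longrightarrow> y = s"
    by (auto simp: univoque_def)
  then show "t \<in> proj q ` {x. uniq x}" using unique_imp_uniq[of s] by blast
next
  fix t assume "t \<in> proj q ` {x. uniq x}"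
  then obtain x where x: "uniq x" "t = proj q x" by auto
  then have d: "digits M x" by (simp add: uniq_def)
  then show "t \<in> univoque M q"
    using x proj_nonneg[OF q_gt_1 d] proj_le[OF q_gt_1 d] uniq_imp_unique[OF x(1)] by (auto simp: univoque_def)
qed

text \<open>Past one digit below \<open>M\<close> and one positive digit, both families of tail
  inequalities persist. Only the constant sequences 0 and \<open>M\<close> lack one of the
  two.\<close>

lemma uniq_imp_eventually_Vq:
  assumes x: "uniq x" "x \<noteq> (\<lambda>_. 0)" "x \<noteq> (\<lambda>_. M)"
  shows "\<exists>n. shift n x \<in> Vq M q"
proof -
  have d: "digits M x" using x by (simp add: uniq_def)
  obtain i where i: "0 < x i" using x(2) by auto
  obtain j where j: "x j < M" using x(3) digitsD[OF d] by (metis ext le_neq_implies_less)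
  let ?n = "Suc (max i j)"
  have "lex_less (shift k (shift ?n x)) \<alpha>" for k
    using uniq_tail_less[OF x(1) j, of "k + max i j"] by simp
  moreover have "lex_less (shift k (shift ?n (reflect M x))) \<alpha>" for k
    using uniq_tail_less[OF uniq_reflect[OF x(1)], of i "k + max i j"] i digitsD[OF d, of i] by (simp add: reflect_def)
  ultimately have "shift ?n x \<in> Vq M q"
    using d unfolding Vq_iff by (simp add: lex_le_def digits_shift shift_reflect)
  then show ?thesis ..
qed

text \<open>On these sequences the inequalities defining the symmetric subshift and those characterising
  unique expansions may differ by strictness.\<close>

definition exceptional :: "(nat \<Rightarrow> nat) set" where
  "exceptional = {y. \<exists>j k. shift j y = shift k \<alpha> \<or> shift j y = shift k (reflect M \<alpha>)}"

lemma countable_exceptional: "countable exceptional"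
proof -
  have "exceptional \<subseteq> (\<lambda>(w, k, b). cat w (shift k (if b then \<alpha> else reflect M \<alpha>))) ` (UNIV :: (nat list \<times> nat \<times> bool) set)"
  proof
    fix y assume "y \<in> exceptional"
    then obtain j k where "shift j y = shift k \<alpha> \<or> shift j y = shift k (reflect M \<alpha>)" by (auto simp: exceptional_def)
    then obtain b :: bool where "shift j y = shift k (if b then \<alpha> else reflect M \<alpha>)" by (metis (full_types))
    then have "y = cat (pre j y) (shift k (if b then \<alpha> else reflect M \<alpha>))" by (metis cat_pre_shift)
    then show "y \<in> (\<lambda>(w, k, b). cat w (shift k (if b then \<alpha> else reflect M \<alpha>))) ` (UNIV :: (nat list \<times> nat \<times> bool) set)"
      by (intro image_eqI[of _ _ "(pre j y, k, b)"]) auto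
  qed
  then show ?thesis using countable_subset by (meson countable_image countableI_type)
qed

section \<open>Replacing the tail of a unique expansion\<close>

lemma exceptional_reflect:
  assumes "digits M y" "reflect M y \<in> exceptional" shows "y \<in> exceptional"
proof -
  obtain j k where "shift j (reflect M y) = shift k \<alpha> \<or> shift j (reflect M y) = shift k (reflect M \<alpha>)"
    using assms(2) by (auto simp: exceptional_def)
  then have "shift j y = shift k (reflect M \<alpha>) \<or> shift j y = shift k \<alpha>"
    by (metis assms(1) digits_\<alpha> digits_shift reflect_reflect shift_reflect)
  then show ?thesis unfolding exceptional_def by blast
qed

text \<open>If a tail of \<open>cat w y\<close> were \<open>\<alpha>\<close> or its reflection,
  shifting by \<open>length w\<close> more places would turn it into a tail of \<open>y\<close>
  equal to a tail of \<open>\<alpha>\<close> or of its reflection, whatever \<open>w\<close>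
  is.\<close>

lemma Vq_strict:
  assumes "cat w y \<in> Vq M q" "y \<notin> exceptional"
  shows "lex_less (shift n (cat w y)) \<alpha>" "lex_less (shift n (reflect M (cat w y))) \<alpha>"
proof -
  have *: "shift n (shift (length w) z) = shift (length w) (shift n z)" for z :: "nat \<Rightarrow> nat" by (simp add: add.commute)
  have "shift n y \<noteq> shift (length w) \<alpha>" "shift n y \<noteq> shift (length w) (reflect M \<alpha>)"
    using assms(2) by (auto simp: exceptional_def)
  then have "shift n (cat w y) \<noteq> \<alpha>" "shift n (cat w y) \<noteq> reflect M \<alpha>"
    using *[of "cat w y"] unfolding shift_cat_length by metis+
  moreover have "shift n (cat w y) = reflect M \<alpha>" if "shift n (reflect M (cat w y)) = \<alpha>"
    using that digits_shift[OF digits_Vq[OF assms(1)], of n] by (metis reflect_reflect shift_reflect)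
  ultimately show "lex_less (shift n (cat w y)) \<alpha>" "lex_less (shift n (reflect M (cat w y))) \<alpha>"
    using assms(1) by (auto simp: Vq_iff lex_less_iff_le_neq)
qed

text \<open>Inside the block of zeros each tail is at most the next one, so strictness travels
  backwards from \<open>y\<close>. Reflected tails are constrained only after positive digits, all
  of which lie in \<open>y\<close>. This serves the constant unique expansion 0.\<close>

lemma uniq_cat_zeros:
  assumes y: "y \<in> Vq M q" "y \<notin> exceptional"
  shows "uniq (cat (pre n (\<lambda>_. 0)) y)"
proof -
  let ?X = "cat (pre n (\<lambda>_. 0)) y"
  have d: "digits M ?X" using digits_Vq[OF y(1)] by (auto simp: digits_cat pre_def)
  have ge: "lex_less (shift i ?X) \<alpha>" "lex_less (shift i (reflect M ?X)) \<alpha>" if "n \<le> i" for i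
    using Vq_strict[of "[]" y] y that by (simp_all add: shift_cat_ge reflect_cat)
  have "lex_less (shift i ?X) \<alpha>" if "i \<le> n" for i
    using that
  proof (induction i rule: inc_induct)
    case base
    then show ?case using ge by blast
  next
    case (step i)
    have zero: "shift i ?X 0 = 0" using step by (simp add: shift_def cat_def)
    have "lex_le (shift i ?X) (shift (Suc i) ?X)"
      using lex_le_shift_zero[OF digits_shift[OF d, of i]] zero by simp
    then show ?case using step lex_le_less_trans by blast
  qed
  then have "lex_less (shift i ?X) \<alpha>" for i using ge by (meson nat_le_linear)
  moreover have "n \<le> i" if "0 < ?X i" for i using that by (auto simp: cat_def split: if_splits)
  ultimately show ?thesis using d ge unfolding uniq_def by (meson le_SucI)
qed

text \<open>Conditions at indices below \<open>K\<close> are finitely many open ones, kept by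
  agreement with \<open>x\<close> on a long prefix. Later ones concern tails of
  \<open>cat u y\<close>, where \<open>u\<close> is the segment of \<open>x\<close> from
  \<open>K\<close> to \<open>L\<close>.\<close>

lemma uniq_perturbation_nonconstant:
  assumes x: "uniq x" and K: "shift K x \<in> Vq M q"
  shows "\<exists>L\<ge>n. \<exists>u. (\<exists>y. cat u y \<in> Vq M q) \<and>
    (\<forall>y. cat u y \<in> Vq M q \<longrightarrow> y \<notin> exceptional \<longrightarrow> uniq (cat (pre L x) y))"
proof -
  have d: "digits M x" using x by (simp add: uniq_def)
  define P where "P X i \<longleftrightarrow> (X i < M \<longrightarrow> lex_less (shift (Suc i) X) \<alpha>)
     \<and> (0 < X i \<longrightarrow> lex_less (shift (Suc i) (reflect M X)) \<alpha>)" for X i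
  have "\<exists>N. \<forall>i<k. \<forall>X. pre N X = pre N x \<longrightarrow> P X i" for k
  proof (induction k)
    case (Suc k)
    then obtain N where N: "\<forall>i<k. \<forall>X. pre N X = pre N x \<longrightarrow> P X i" by blast
    obtain a where a: "x k < M \<Longrightarrow> \<forall>z. pre a z = pre a (shift (Suc k) x) \<longrightarrow> lex_less z \<alpha>"
      using x lex_less_pre_cong unfolding uniq_def by meson
    obtain b where b: "0 < x k \<Longrightarrow> \<forall>z. pre b z = pre b (shift (Suc k) (reflect M x)) \<longrightarrow> lex_less z \<alpha>"
      using x lex_less_pre_cong unfolding uniq_def by meson
    \<comment> \<open>Enough digits to preserve the conditions before \<open>k\<close> and to decide
      both comparisons that start at index \<open>k + 1\<close>.\<close>
    let ?N = "N + (Suc k + a) + (Suc k + b)"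
    have "P X k" if X: "pre ?N X = pre ?N x" for X
    proof -
      have "X k = x k" using pre_eqD[OF X, of k] by simp
      moreover have "pre a (shift (Suc k) X) = pre a (shift (Suc k) x)"
        using X by (intro pre_shift_cong) (rule pre_eq_mono, auto)
      moreover have "pre b (shift (Suc k) (reflect M X)) = pre b (shift (Suc k) (reflect M x))"
        unfolding shift_reflect pre_reflect using X
        by (intro arg_cong[of _ _ "map _"] pre_shift_cong) (rule pre_eq_mono, auto)
      ultimately show ?thesis using a b unfolding P_def by metis
    qed
    moreover have "P X i" if X: "pre ?N X = pre ?N x" "i < k" for X i
      using N that(2) pre_eq_mono[OF X(1), of N] by auto
    ultimately show ?case by (intro exI[of _ ?N]) (auto simp: less_Suc_eq)
  qed simp
  then obtain N where N: "\<And>i X. i < K \<Longrightarrow> pre N X = pre N x \<Longrightarrow> P X i" by blast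
  \<comment> \<open>\<open>L\<close> exceeds \<open>N\<close> for the early conditions,
    \<open>K\<close> so that \<open>u\<close> reaches back to where \<open>x\<close> has entered the
    subshift, and \<open>n\<close> for closeness to \<open>x\<close>.\<close>
  define L where "L = N + K + n"
  define u where "u = drop K (pre L x)"
  have KL: "K \<le> L" by (simp add: L_def)
  have "cat u (shift L x) = shift K x"
    using shift_cat[of K "pre L x" "shift L x"] KL by (simp add: u_def)
  then have "\<exists>y. cat u y \<in> Vq M q" using K by metis
  moreover have "uniq (cat (pre L x) y)" if y: "cat u y \<in> Vq M q" "y \<notin> exceptional" for y
  proof -
    let ?X = "cat (pre L x) y"
    have sK: "shift K ?X = cat u y" using shift_cat[of K "pre L x" y] KL by (simp add: u_def)
    have "digits M y" using digits_Vq[OF y(1)] by (simp add: digits_cat)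
    then have dX: "digits M ?X" using set_pre[OF d] by (simp add: digits_cat)
    have "P ?X i" for i
    proof (cases "i < K")
      case True
      have "pre L ?X = pre L x" using pre_length_cat[of "pre L x" y] by simp
      then have "pre N ?X = pre N x" by (rule pre_eq_mono) (simp add: L_def)
      then show ?thesis using N True by blast
    next
      case False
      then have e: "shift (Suc i) Y = shift (Suc i - K) (shift K Y)" for Y :: "nat \<Rightarrow> nat" by simp
      show ?thesis unfolding P_def using Vq_strict[OF y, of "Suc i - K"] sK
        by (metis e shift_reflect)
    qed
    then show ?thesis using dX by (simp add: P_def uniq_def)
  qed
  ultimately show ?thesis by (intro exI[of _ L]) (auto simp: L_def)
qed

text \<open>Arbitrarily close to any unique expansion there is thus a copy of a nonempty set of
  continuations \<open>y\<close>, all of them unique expansions up to \<open>exceptional\<close>. A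
  lower bound for such sets is therefore local.\<close>

lemma uniq_perturbation:
  assumes x: "uniq x" and ne: "Vq M q \<noteq> {}"
  shows "\<exists>L\<ge>n. \<exists>u. (\<exists>y. cat u y \<in> Vq M q) \<and>
    (\<forall>y. cat u y \<in> Vq M q \<longrightarrow> y \<notin> exceptional \<longrightarrow> uniq (cat (pre L x) y))"
proof -
  consider "x = (\<lambda>_. 0)" | "x = (\<lambda>_. M)" | "x \<noteq> (\<lambda>_. 0)" "x \<noteq> (\<lambda>_. M)" by blast
  then show ?thesis
  proof cases
    case 1
    then show ?thesis using ne uniq_cat_zeros[of _ n] by (intro exI[of _ n] conjI exI[of _ "[]"]) auto
  next
    case 2
    have "uniq (cat (pre n x) y)" if y: "y \<in> Vq M q" "y \<notin> exceptional" for y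
    proof -
      have "uniq (cat (pre n (\<lambda>_. 0)) (reflect M y))"
        using y reflect_Vq exceptional_reflect digits_Vq by (intro uniq_cat_zeros) blast+
      then have "uniq (reflect M (cat (pre n (\<lambda>_. 0)) (reflect M y)))" by (rule uniq_reflect)
      moreover have "map (\<lambda>d. M - d) (pre n (\<lambda>_. 0)) = pre n x" using 2 by (simp add: pre_def)
      ultimately show ?thesis using digits_Vq[OF y(1)] by (simp add: reflect_cat)
    qed
    then show ?thesis using ne by (intro exI[of _ n] conjI exI[of _ "[]"]) auto
  next
    case 3
    then show ?thesis using uniq_imp_eventually_Vq[OF x] uniq_perturbation_nonconstant[OF x] by blast
  qed
qed

end

section \<open>Entropy\<close>

lemma words_eq: "words X n = (\<Union>k. pre n ` shift k ` X)"
  unfolding words_def pre_def shift_def by (auto simp: add.commute)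

lemma finite_pre_image:
  assumes "\<And>x. x \<in> X \<Longrightarrow> digits M x"
  shows "finite (pre n ` X)" "card (pre n ` X) \<le> (M + 1) ^ n"
proof -
  have sub: "pre n ` X \<subseteq> {w. set w \<subseteq> {..M} \<and> length w = n}" by (auto dest: set_pre[OF assms, THEN subsetD])
  have fin: "finite {w :: nat list. set w \<subseteq> {..M} \<and> length w = n}" by (rule finite_lists_length_eq) simp
  show "finite (pre n ` X)" using sub fin finite_subset by blast
  show "card (pre n ` X) \<le> (M + 1) ^ n"
    using card_mono[OF fin sub] card_lists_length_eq[of "{..M}" n] by simp
qed

lemma words_shift_invariant:
  assumes "\<And>x n. x \<in> X \<Longrightarrow> shift n x \<in> X"
  shows "words X n = pre n ` X"
  unfolding words_eq
proof (intro equalityI subsetI)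
  fix w assume "w \<in> (\<Union>k. pre n ` shift k ` X)"
  then show "w \<in> pre n ` X" using assms by blast
next
  fix w assume "w \<in> pre n ` X"
  then have "w \<in> pre n ` shift 0 ` X" by auto
  then show "w \<in> (\<Union>k. pre n ` shift k ` X)" by blast
qed

lemma card_pre_add_le:
  assumes "\<And>x. x \<in> X \<Longrightarrow> digits M x" "\<And>x n. x \<in> X \<Longrightarrow> shift n x \<in> X"
  shows "card (pre (m + n) ` X) \<le> card (pre m ` X) * card (pre n ` X)"
proof -
  have fin: "finite (pre k ` X)" for k using assms(1) by (rule finite_pre_image(1))
  have "pre (m + n) ` X \<subseteq> (\<lambda>(u, v). u @ v) ` (pre m ` X \<times> pre n ` X)"
    using assms(2) by (force simp: pre_add)
  then have "card (pre (m + n) ` X) \<le> card (pre m ` X \<times> pre n ` X)"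
    using fin by (meson card_image_le card_mono finite_SigmaI finite_imageI order_trans)
  then show ?thesis by (simp add: card_cartesian_product)
qed

text \<open>Fekete's subadditive lemma. The limit is also a lower bound at every \<open>n\<close>;
  this half later removes subexponential losses from word counts.\<close>

lemma fekete:
  fixes a :: "nat \<Rightarrow> real"
  assumes sub: "\<And>m n. a (m + n) \<le> a m + a n" and nonneg: "\<And>n. 0 \<le> a n"
  shows "\<exists>l\<ge>0. (\<lambda>n. a n / real n) \<longlonglongrightarrow> l \<and> (\<forall>n\<ge>1. l \<le> a n / real n)"
proof -
  define l where "l = (INF n\<in>{1..}. a n / real n)"
  have bdd: "bdd_below ((\<lambda>n. a n / real n) ` {1..})" using nonneg by (intro bdd_belowI[of _ 0]) auto
  have l_le: "l \<le> a n / real n" if "n \<ge> 1" for n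
    unfolding l_def using that bdd by (intro cINF_lower) auto
  have l0: "0 \<le> l" unfolding l_def using nonneg by (intro cINF_greatest) auto
  have mult: "a (k * m) \<le> real k * a m" if "k \<ge> 1" for k m
    using that
  proof (induction k rule: dec_induct)
    case (step k)
    then show ?case using sub[of m "k * m"] by (simp add: algebra_simps)
  qed simp
  have "(\<lambda>n. a n / real n) \<longlonglongrightarrow> l"
  proof (rule order_tendstoI)
    fix y assume "y < l"
    then show "\<forall>\<^sub>F n in sequentially. y < a n / real n"
      using l_le by (intro eventually_sequentiallyI[of 1]) (meson less_le_trans)
  next
    fix y assume y: "l < y"
    then obtain m where m: "m \<ge> 1" "a m / real m < y"
      unfolding l_def using cINF_less_iff[OF _ bdd] by auto
    define K where "K = (\<Sum>i<m. a i) + a 0"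
    have K: "a i \<le> K" if "i < m" for i
      unfolding K_def using that nonneg member_le_sum[of i "{..<m}" a] by (simp add: add_increasing2)
    have K0: "0 \<le> K" unfolding K_def using nonneg by (simp add: sum_nonneg)
    have bound: "a n / real n \<le> a m / real m + K / real n" if n: "n \<ge> m" for n
    proof -
      have "a n = a ((n div m) * m + n mod m)" by simp
      also have "\<dots> \<le> a ((n div m) * m) + a (n mod m)" by (rule sub)
      also have "\<dots> \<le> real (n div m) * a m + K"
        using mult[of "n div m" m] n m K[of "n mod m"] by (simp add: add_mono div_greater_zero_iff Suc_le_eq)
      also have "real (n div m) * a m = real (n div m * m) * (a m / real m)" using m by simp
      also have "\<dots> \<le> real n * (a m / real m)"
        using nonneg[of m] by (intro mult_right_mono) (simp_all only: of_nat_le_iff div_times_less_eq_dividend, simp)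
      finally have "a n \<le> real n * (a m / real m) + K" by simp
      then have "a n / real n \<le> (real n * (a m / real m) + K) / real n" by (intro divide_right_mono) auto
      then show ?thesis using n m by (simp add: add_divide_distrib)
    qed
    have "(\<lambda>n. a m / real m + K / real n) \<longlonglongrightarrow> a m / real m + 0"
      by (intro tendsto_intros lim_const_over_n)
    then have "\<forall>\<^sub>F n in sequentially. a m / real m + K / real n < y" using m by (intro order_tendstoD) auto
    then show "\<forall>\<^sub>F n in sequentially. a n / real n < y"
      using eventually_ge_at_top[of m]
    proof eventually_elim
      case (elim n)
      then show ?case using bound[of n] by linarith
    qed
  qed
  then show ?thesis using l0 l_le by blast
qed

section \<open>The entropy as a limit and as an infimum\<close>

context expansion_base
begin

lemma words_Vq: "words (Vq M q) n = pre n ` Vq M q"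
  using shift_Vq by (rule words_shift_invariant)

lemma finite_words_Vq: "finite (pre n ` Vq M q)"
  using digits_Vq by (rule finite_pre_image(1))

lemma ln_real_nat_nonneg: "0 \<le> ln (real (n :: nat))"
  by (cases n) auto

lemma entropy_limit:
  shows entropy_nonneg: "0 \<le> entropy M q"
    and entropy_tendsto: "(\<lambda>n. ln (real (card (pre n ` Vq M q))) / real n) \<longlonglongrightarrow> entropy M q"
    and entropy_le: "n \<ge> 1 \<Longrightarrow> entropy M q \<le> ln (real (card (pre n ` Vq M q))) / real n"
proof -
  let ?a = "\<lambda>n. ln (real (card (pre n ` Vq M q)))"
  have "?a (m + n) \<le> ?a m + ?a n" for m n
  \<comment> \<open>The convention \<open>ln 0 = 0\<close> assigns entropy 0 to an empty subshift;
    subadditivity is then mere nonnegativity.\<close>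
  proof (cases "card (pre (m + n) ` Vq M q) = 0")
    case True
    then show ?thesis using ln_real_nat_nonneg by (simp add: add_nonneg_nonneg)
  next
    case False
    have le: "card (pre (m + n) ` Vq M q) \<le> card (pre m ` Vq M q) * card (pre n ` Vq M q)"
      using digits_Vq shift_Vq by (rule card_pre_add_le)
    then have pos: "0 < card (pre m ` Vq M q)" "0 < card (pre n ` Vq M q)"
      using False by (metis le_zero_eq mult_eq_0_iff neq0_conv)+
    have "?a (m + n) \<le> ln (real (card (pre m ` Vq M q) * card (pre n ` Vq M q)))"
      using le False by (intro ln_mono) (simp_all only: of_nat_le_iff of_nat_0_less_iff)
    also have "\<dots> = ?a m + ?a n" using pos by (simp add: ln_mult)
    finally show ?thesis .
  qed
  then obtain l where l: "0 \<le> l" "(\<lambda>n. ?a n / real n) \<longlonglongrightarrow> l" "\<And>n. n \<ge> 1 \<Longrightarrow> l \<le> ?a n / real n"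
    using fekete[of ?a] ln_real_nat_nonneg by blast
  have "entropy M q = l" unfolding entropy_def words_Vq using l(2) by (rule limI)
  with l show "0 \<le> entropy M q" "(\<lambda>n. ?a n / real n) \<longlonglongrightarrow> entropy M q" "n \<ge> 1 \<Longrightarrow> entropy M q \<le> ?a n / real n"
    by auto
qed

end

section \<open>Monotonicity and the largest value of the entropy\<close>

lemma entropy_mono:
  assumes "1 < p" "p \<le> q" "q \<le> real M + 1"
  shows "entropy M p \<le> entropy M q"
proof -
  interpret p: expansion_base M p using assms by unfold_locales auto
  interpret q: expansion_base M q using assms by unfold_locales auto
  have "Vq M p \<subseteq> Vq M q"
    using lex_le_trans[OF _ quasi_greedy_mono[OF assms]] by (auto simp: p.Vq_iff q.Vq_iff)
  then have "card (pre n ` Vq M p) \<le> card (pre n ` Vq M q)" for n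
    using q.finite_words_Vq by (intro card_mono image_mono)
  then have "ln (real (card (pre n ` Vq M p))) \<le> ln (real (card (pre n ` Vq M q)))" for n
    using p.ln_real_nat_nonneg by (cases "card (pre n ` Vq M p) = 0") (auto intro!: ln_mono)
  then show ?thesis
    using p.entropy_tendsto q.entropy_tendsto by (intro LIMSEQ_le) (auto intro!: divide_right_mono)
qed

lemma entropy_top:
  assumes "M \<ge> 1"
  shows "entropy M (real M + 1) = ln (real M + 1)"
proof -
  interpret expansion_base M "real M + 1" using assms by unfold_locales auto
  have top: "\<alpha> = (\<lambda>_. M)" using assms by (rule quasi_greedy_top)
  have "lex_le x (\<lambda>_. M)" if "digits M x" for x
    using digitsD[OF that] by (auto simp: lex_le_iff_not_less lex_less_def not_less)
  then have V: "Vq M (real M + 1) = {x. digits M x}"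
    by (auto simp: Vq_iff top digits_shift)
  have "pre n ` {x. digits M x} = {w. set w \<subseteq> {..M} \<and> length w = n}" for n
  proof (intro equalityI subsetI)
    fix w assume w: "w \<in> {w. set w \<subseteq> {..M} \<and> length w = n}"
    then have "digits M (cat w (\<lambda>_. 0))" by (simp add: digits_cat) (simp add: digits_def)
    moreover have "pre n (cat w (\<lambda>_. 0)) = w" using w by auto
    ultimately show "w \<in> pre n ` {x. digits M x}" by (metis image_eqI mem_Collect_eq)
  qed (use set_pre in auto)
  then have c: "card (pre n ` Vq M (real M + 1)) = (M + 1) ^ n" for n
    by (simp add: V card_lists_length_eq)
  have "ln (real (card (pre n ` Vq M (real M + 1)))) / real n = ln (real M + 1)" if "n \<ge> 1" for n
    unfolding c using that by (simp add: ln_realpow add.commute)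
  then have "(\<lambda>n. ln (real (card (pre n ` Vq M (real M + 1)))) / real n) \<longlonglongrightarrow> ln (real M + 1)"
    by (intro tendsto_eventually eventually_sequentiallyI[of 1]) 
  then show ?thesis using entropy_tendsto LIMSEQ_unique by blast
qed

text \<open>As \<alpha>(q) is not constantly \<open>M\<close>, a sufficiently long block of digits
  \<open>M\<close> is forbidden. One missing word of one length suffices, because entropy is bounded
  by the growth rate at each finite length.\<close>

lemma entropy_less_top:
  assumes "1 < q" "q < real M + 1"
  shows "entropy M q < ln (real M + 1)"
proof -
  interpret expansion_base M q using assms by unfold_locales auto
  have "\<alpha> \<noteq> (\<lambda>_. M)"
    using proj_quasi_greedy[OF q_gt_1 q_le] proj_const[OF q_gt_1, of M] assms by auto
  then obtain n where n: "\<forall>i<n. \<alpha> i = M" "\<alpha> n \<noteq> M" by (rule first_difference)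
  let ?W = "{w. set w \<subseteq> {..M} \<and> length w = Suc n}" and ?m = "replicate (Suc n) M"
  have "pre (Suc n) x \<noteq> ?m" if x: "x \<in> Vq M q" for x
  proof
    assume "pre (Suc n) x = ?m"
    then have "x i = M" if "i \<le> n" for i using that by (metis less_Suc_eq_le nth_replicate pre_nth)
    then have "lex_less \<alpha> x" using n digitsD[OF digits_\<alpha>, of n] by (auto simp: lex_less_def intro!: exI[of _ n])
    moreover have "lex_le (shift 0 x) \<alpha>" using x unfolding Vq_iff by blast
    ultimately show False by (simp add: lex_le_iff_not_less)
  qed
  then have "?m \<notin> pre (Suc n) ` Vq M q" by force
  moreover have "?m \<in> ?W" by auto
  moreover have "pre (Suc n) ` Vq M q \<subseteq> ?W" by (auto dest: set_pre[OF digits_Vq, THEN subsetD])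
  ultimately have "pre (Suc n) ` Vq M q \<subset> ?W" by blast
  moreover have "finite ?W" by (rule finite_lists_length_eq) simp
  ultimately have "card (pre (Suc n) ` Vq M q) < card ?W" by (rule psubset_card_mono[rotated])
  then have less: "card (pre (Suc n) ` Vq M q) < (M + 1) ^ Suc n" by (simp add: card_lists_length_eq)
  have M1: "1 < real M + 1" using assms by simp
  have "ln (real (card (pre (Suc n) ` Vq M q))) < ln (real ((M + 1) ^ Suc n))"
  proof (cases "card (pre (Suc n) ` Vq M q) = 0")
    case True
    have "1 < (M + 1) ^ Suc n" using M1 by (intro one_less_power) auto
    then have "real 1 < real ((M + 1) ^ Suc n)" by (simp only: of_nat_less_iff)
    then have "0 < ln (real ((M + 1) ^ Suc n))" by (intro ln_gt_zero) (simp only: of_nat_1)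
    then show ?thesis using True by simp
  next
    case False
    then have "0 < real (card (pre (Suc n) ` Vq M q))" by (simp only: of_nat_0_less_iff neq0_conv)
    moreover have "real (card (pre (Suc n) ` Vq M q)) < real ((M + 1) ^ Suc n)"
      using less by (simp only: of_nat_less_iff)
    ultimately show ?thesis by (meson ln_less_cancel_iff less_trans)
  qed
  also have "\<dots> = real (Suc n) * ln (real M + 1)" using M1 by (simp add: ln_realpow add.commute del: power_Suc)
  finally have "ln (real (card (pre (Suc n) ` Vq M q))) / real (Suc n) < ln (real M + 1)"
    by (simp add: divide_less_eq mult.commute)
  then show ?thesis using entropy_le[of "Suc n"] by simp
qed

section \<open>Entropy plateaus\<close>

lemma gap_in_components:
  fixes l r :: real
  assumes "l < r" "{l<..<r} \<subseteq> S" "l \<notin> S" "r \<notin> S"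
  shows "{l<..<r} \<in> components S"
  unfolding in_components_maximal
proof (intro conjI allI impI)
  fix D assume D: "D \<noteq> {} \<and> {l<..<r} \<subseteq> D \<and> D \<subseteq> S \<and> connected D"
  have mid: "(l + r) / 2 \<in> D" using D assms(1) by (intro subsetD[of "{l<..<r}" D]) auto
  have "x \<in> {l<..<r}" if x: "x \<in> D" for x
  proof (rule ccontr)
    assume "\<not> ?thesis"
    then have "x \<le> l \<or> r \<le> x" by auto
    then have "l \<in> D \<or> r \<in> D"
      using D x mid assms(1) connectedD_interval[of D x "(l + r) / 2" l] connectedD_interval[of D "(l + r) / 2" x r]
      by (auto simp: field_simps)
    then show False using D assms by blast
  qed
  then show "D = {l<..<r}" using D by blast
qed (use assms in auto)

text \<open>If \<open>C\<close> missed \<open>(p, q)\<close>, the gap could be widened to the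
  nearest points of \<open>C\<close> on both sides. Its interior would be a component whose
  half-open interval contains \<open>q\<close>.\<close>

lemma accumulates_from_left:
  fixes C :: "real set"
  assumes C: "closed C" "b \<in> C" and q: "a < q" "q \<le> b"
    and nq: "q \<notin> \<Union>{{l<..r} | l r. {l<..<r} \<in> components ({a<..b} - C)}"
    and p: "a \<le> p" "p < q"
  shows "C \<inter> {p<..<q} \<noteq> {}"
proof
  assume gap: "C \<inter> {p<..<q} = {}"
  \<comment> \<open>The point \<open>a\<close> counts as a wall: it bounds the ambient interval
    without belonging to it. On the right, \<open>b \<in> C\<close> plays this role for
    \<open>R\<close>.\<close>
  define L where "L = insert a C \<inter> {a..p}"
  define R where "R = C \<inter> {q..b}"
  have L: "Sup L \<in> L" "\<And>x. x \<in> L \<Longrightarrow> x \<le> Sup L"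
  proof -
    have "closed L" unfolding L_def using C by (intro closed_Int closed_insert closed_atLeastAtMost)
    moreover have "bdd_above L" "L \<noteq> {}" using p by (auto simp: L_def)
    ultimately show "Sup L \<in> L" "\<And>x. x \<in> L \<Longrightarrow> x \<le> Sup L"
      by (simp_all add: closed_contains_Sup cSup_upper)
  qed
  have R: "Inf R \<in> R" "\<And>x. x \<in> R \<Longrightarrow> Inf R \<le> x"
  proof -
    have "closed R" "bdd_below R" "R \<noteq> {}" using C q by (auto simp: R_def intro!: closed_Int)
    then show "Inf R \<in> R" "\<And>x. x \<in> R \<Longrightarrow> Inf R \<le> x"
      by (simp_all add: closed_contains_Inf cInf_lower)
  qed
  have Lr: "a \<le> Sup L" "Sup L \<le> p" "Sup L \<notin> {a<..b} - C" proof -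
    have "a \<le> x \<and> x \<le> p \<and> x \<notin> {a<..b} - C" if "x \<in> L" for x using that by (auto simp: L_def)
    with L(1) show "a \<le> Sup L" "Sup L \<le> p" "Sup L \<notin> {a<..b} - C" by blast+
  qed
  have Rr: "q \<le> Inf R" "Inf R \<le> b" "Inf R \<notin> {a<..b} - C" proof -
    have "q \<le> x \<and> x \<le> b \<and> x \<notin> {a<..b} - C" if "x \<in> R" for x using that by (auto simp: R_def)
    with R(1) show "q \<le> Inf R" "Inf R \<le> b" "Inf R \<notin> {a<..b} - C" by blast+
  qed
  have "{Sup L<..<Inf R} \<subseteq> {a<..b} - C"
  proof
    fix x assume x: "x \<in> {Sup L<..<Inf R}"
    have "x \<notin> C"
    proof
      assume xC: "x \<in> C"
      consider "x \<le> p" | "p < x \<and> x < q" | "q \<le> x" by linarith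
      then show False
      proof cases
        case 1
        have "a < x" using x Lr by simp
        then have "x \<in> L" using 1 xC by (simp add: L_def)
        then show False using L(2) x by fastforce
      next
        case 2
        then show False using gap xC by auto
      next
        case 3
        have "x < b" using x Rr by simp
        then have "x \<in> R" using 3 xC by (simp add: R_def)
        then show False using R(2) x by fastforce
      qed
    qed
    then show "x \<in> {a<..b} - C" using x Lr Rr by auto
  qed
  then have "{Sup L<..<Inf R} \<in> components ({a<..b} - C)"
    using Lr Rr p by (intro gap_in_components) auto
  moreover have "q \<in> {Sup L<..Inf R}" using Lr Rr p by auto
  ultimately show False using nq by blast
qed

lemma top_in_bifset:
  assumes "M \<ge> 1" shows "real M + 1 \<in> bifset M"
  unfolding bifset_def
proof (intro CollectI conjI ballI impI)
  fix p assume "p \<in> {1<..real M + 1}" "p \<noteq> real M + 1"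
  then show "entropy M p \<noteq> entropy M (real M + 1)"
    using entropy_less_top[of p M] entropy_top[OF assms] by auto
qed (use assms in auto)

text \<open>An open interval meeting the closure meets \<open>bifset M\<close> itself, so some
  \<open>b\<close> of it lies between \<open>p\<close> and \<open>q\<close>. Monotonicity gives
  \<open>H(p) \<le> H(b) \<le> H(q)\<close>, and membership of \<open>b\<close> makes the first
  inequality strict.\<close>

lemma entropy_increases_at:
  assumes M: "M \<ge> 1" and q: "q \<in> {q_KL M<..real M + 1}"
    and nq: "q \<notin> (\<Union>{{pL<..pR} | pL pR. entropy_plateau M pL pR})"
  shows "1 < q" "\<And>p. 1 < p \<Longrightarrow> p < q \<Longrightarrow> entropy M p < entropy M q"
proof -
  have left: "\<exists>b\<in>bifset M. p < b \<and> b < q" if "q_KL M \<le> p" "p < q" for p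
  proof -
    have "closure (bifset M) \<inter> {p<..<q} \<noteq> {}"
      using q nq that subsetD[OF closure_subset top_in_bifset[OF M]]
      by (intro accumulates_from_left[of _ "real M + 1" "q_KL M"]) (auto simp: entropy_plateau_def)
    then have "bifset M \<inter> {p<..<q} \<noteq> {}"
      by (metis inf_commute open_Int_closure_eq_empty open_greaterThanLessThan)
    then show ?thesis by auto
  qed
  \<comment> \<open>Points of \<open>bifset M\<close> exceed 1 by definition, so one below
    \<open>q\<close> yields \<open>1 < q\<close>; the definite description \<open>q_KL M\<close>
    stays opaque.\<close>
  have "\<exists>b\<in>bifset M. q_KL M < b \<and> b < q" using left q by simp
  then show "1 < q" by (auto simp: bifset_def)
  fix p assume p: "1 < p" "p < q"
  obtain b where b: "b \<in> bifset M" "max p (q_KL M) < b" "b < q" using left[of "max p (q_KL M)"] p q by auto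
  have "entropy M p \<le> entropy M b" "entropy M p \<noteq> entropy M b" "entropy M b \<le> entropy M q"
    using b p q by (auto intro!: entropy_mono simp: bifset_def)
  then show "entropy M p < entropy M q" by simp
qed

section \<open>Counting words that may follow a given word\<close>

lemma sum_delayed_le:
  fixes g :: "nat \<Rightarrow> real"
  assumes "\<And>n. 0 \<le> g n"
  shows "(\<Sum>n<T. if l \<le> n then g (n - l) else 0) \<le> (\<Sum>n<T. g n)"
proof -
  have "(\<Sum>n<T. if l \<le> n then g (n - l) else 0) = (\<Sum>n\<in>{..<T} \<inter> {n. l \<le> n}. g (n - l))"
    by (simp add: sum.inter_restrict)
  also have "\<dots> = sum g ((\<lambda>n. n - l) ` ({..<T} \<inter> {n. l \<le> n}))"
    by (subst sum.reindex) (auto simp: inj_on_def)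
  also have "\<dots> \<le> sum g {..<T}" using assms by (intro sum_mono2) auto
  finally show ?thesis .
qed

text \<open>With \<open>K\<close> the sum of the first \<open>n0 + m\<close> terms, a partial sum
  \<open>S\<close> satisfies \<open>S \<le> K + \<rho> S\<close>.\<close>

lemma delayed_contraction_summable:
  fixes c :: "nat \<Rightarrow> real"
  assumes nonneg: "\<And>n. 0 \<le> c n" and \<rho>: "0 \<le> \<rho>" "\<rho> < 1"
    and step: "\<And>n. n \<ge> n0 \<Longrightarrow> c (n + m) \<le> \<rho> * c n"
  shows "\<exists>K\<ge>0. \<forall>T. (\<Sum>n<T. c n) \<le> K"
proof -
  define K where "K = (\<Sum>n<n0 + m. c n)"
  have K0: "0 \<le> K" unfolding K_def using nonneg by (intro sum_nonneg) auto
  have "(\<Sum>n<T. c n) \<le> K / (1 - \<rho>)" for T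
  proof -
    have "c n \<le> (if n < n0 + m then c n else 0) + \<rho> * (if m \<le> n then c (n - m) else 0)" for n
      using step[of "n - m"] nonneg \<rho> by (cases "n < n0 + m") auto
    then have "(\<Sum>n<T. c n) \<le> (\<Sum>n<T. (if n < n0 + m then c n else 0) + \<rho> * (if m \<le> n then c (n - m) else 0))"
      by (intro sum_mono)
    also have "\<dots> = (\<Sum>n<T. if n < n0 + m then c n else 0) + \<rho> * (\<Sum>n<T. if m \<le> n then c (n - m) else 0)"
      by (simp add: sum.distrib sum_distrib_left)
    also have "\<dots> \<le> K + \<rho> * (\<Sum>n<T. c n)"
    proof (intro add_mono mult_left_mono \<rho> sum_delayed_le nonneg)
      have "(\<Sum>n<T. if n < n0 + m then c n else 0) = (\<Sum>n\<in>{..<T} \<inter> {n. n < n0 + m}. c n)"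
        by (simp add: sum.inter_restrict)
      also have "\<dots> \<le> K" unfolding K_def using nonneg by (intro sum_mono2) auto
      finally show "(\<Sum>n<T. if n < n0 + m then c n else 0) \<le> K" .
    qed
    finally show ?thesis using \<rho> by (simp add: le_divide_eq algebra_simps)
  qed
  then show ?thesis using K0 \<rho> by (intro exI[of _ "K / (1 - \<rho>)"]) auto
qed

text \<open>The comparison is decided within \<open>n\<close> digits, so either side may be altered
  beyond them: the base that determines \<open>\<alpha>\<close>, or the continuation of a
  word.\<close>

lemma lex_less_of_pre:
  assumes "lex_le x b" "pre n x \<noteq> pre n b" "pre n y = pre n x" "pre n c = pre n b"
  shows "lex_less y c"
proof -
  have "lex_less x b" using assms by (auto simp: lex_le_def)
  then obtain k where k: "\<forall>i<k. x i = b i" "x k < b k" by (auto simp: lex_less_def)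
  have "k < n" using k assms(2) by (metis order_less_le_trans not_le pre_eq_iff)
  then show ?thesis using k pre_eqD[OF assms(3)] pre_eqD[OF assms(4)]
    by (auto simp: lex_less_def intro!: exI[of _ k])
qed

text \<open>The assumption is the only trace of the plateau structure in what follows.\<close>

locale left_entropy_increase = expansion_base +
  assumes entropy_increase: "1 < p \<Longrightarrow> p < q \<Longrightarrow> entropy M p < entropy M q"
begin

definition followers :: "nat list \<Rightarrow> (nat \<Rightarrow> nat) set" where
  "followers w = {y. cat w y \<in> Vq M q}"

definition count :: "nat list \<Rightarrow> nat \<Rightarrow> nat" where
  "count w n = card (pre n ` followers w)"

definition z :: real where "z = exp (- entropy M q)"

definition wsum :: "nat list \<Rightarrow> nat \<Rightarrow> real" where
  "wsum w T = (\<Sum>n<T. real (count w n) * z ^ n)"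

lemma followers_Nil: "followers [] = Vq M q"
  by (simp add: followers_def)

lemma followers_subset: "followers w \<subseteq> Vq M q"
  unfolding followers_def using shift_Vq[of _ "length w"] by (metis (lifting) mem_Collect_eq shift_cat_length subsetI)

lemma digits_followers: "y \<in> followers w \<Longrightarrow> digits M y"
  using followers_subset digits_Vq by blast

lemma finite_pre_followers: "finite (pre n ` followers w)"
  using digits_followers by (rule finite_pre_image(1))

lemma count_mono: "followers v \<subseteq> followers w \<Longrightarrow> count v n \<le> count w n"
  unfolding count_def by (intro card_mono finite_pre_followers image_mono)

lemma z_pos: "0 < z" and entropy_pos: "0 < entropy M q" and z_less_1: "z < 1"
proof -
  obtain p where p: "1 < p" "p < q" using quasi_greedy_left_continuous[OF q_gt_1 q_le] by blast
  interpret p: expansion_base M p using p q_le by unfold_locales auto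
  show "0 < entropy M q" using p.entropy_nonneg entropy_increase[OF p] by simp
  then show "z < 1" by (simp add: z_def)
qed (simp add: z_def)

lemma z_power: "z ^ n = exp (- (real n * entropy M q))"
  unfolding z_def exp_of_nat_mult[symmetric] by simp

lemma wsum_mono: "followers v \<subseteq> followers w \<Longrightarrow> wsum v T \<le> wsum w T"
  unfolding wsum_def using z_pos count_mono by (intro sum_mono mult_right_mono) auto

lemma wsum_nonneg: "0 \<le> wsum w T"
  unfolding wsum_def using z_pos by (intro sum_nonneg) auto

text \<open>The infimum form of entropy gives at least \<open>exp (n H(q))\<close> words of length
  \<open>n\<close> without loss. The resulting divergence of \<open>wsum []\<close> drives the
  contradiction in \<open>followers_cover_weight\<close>.\<close>

lemma count_Nil_ge:
  shows "1 \<le> real (count [] n) * z ^ n" and Vq_nonempty: "Vq M q \<noteq> {}"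
proof -
  have *: "exp (real n * entropy M q) \<le> real (count [] n)" if "n \<ge> 1" for n
  proof -
    have le: "entropy M q \<le> ln (real (count [] n)) / real n"
      using entropy_le[OF that] by (simp add: count_def followers_Nil)
    then have "real n * entropy M q \<le> ln (real (count [] n))" using that by (simp add: field_simps)
    \<comment> \<open>With no words, \<open>ln 0 = 0\<close> would turn the bound into
      \<open>H(q) \<le> 0\<close>. Positive entropy thus also shows that the subshift is
      nonempty.\<close>
    moreover have "count [] n \<noteq> 0"
    proof
      assume "count [] n = 0"
      then show False using le entropy_pos by simp
    qed
    ultimately show ?thesis by (simp add: ln_ge_iff)
  qed
  have "count [] 1 \<noteq> 0"
  proof
    assume "count [] 1 = 0"
    then show False using *[of 1] exp_gt_zero[of "entropy M q"] by simp
  qed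
  then show ne: "Vq M q \<noteq> {}" by (auto simp: count_def followers_Nil)
  show "1 \<le> real (count [] n) * z ^ n"
  proof (cases "n = 0")
    case True
    have "pre 0 ` Vq M q = {[]}" using ne by auto
    then show ?thesis using True by (simp add: count_def followers_Nil)
  next
    case False
    then have "exp (real n * entropy M q) * z ^ n \<le> real (count [] n) * z ^ n"
      using * z_pos by (intro mult_right_mono) auto
    moreover have "exp (real n * entropy M q) * z ^ n = 1" by (simp add: z_power exp_minus)
    ultimately show ?thesis by simp
  qed
qed

lemma wsum_Nil_ge: "real T \<le> wsum [] T"
  unfolding wsum_def using sum_mono[of "{..<T}" "\<lambda>_. 1" "\<lambda>n. real (count [] n) * z ^ n"] count_Nil_ge by simp

section \<open>Words avoiding a prefix of \<open>\<alpha>\<close> and its reflection\<close>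

definition avoiders :: "nat \<Rightarrow> nat \<Rightarrow> (nat \<Rightarrow> nat) set" where
  "avoiders N n = {x \<in> Vq M q. \<forall>i. i + N \<le> n \<longrightarrow>
     pre N (shift i x) \<noteq> pre N \<alpha> \<and> pre N (shift i x) \<noteq> pre N (reflect M \<alpha>)}"

lemma avoiders_shift: "x \<in> avoiders N (m + n) \<Longrightarrow> shift m x \<in> avoiders N n"
  by (auto simp: avoiders_def shift_Vq)

lemma avoiders_antimono: "n \<le> n' \<Longrightarrow> avoiders N n' \<subseteq> avoiders N n"
  by (auto simp: avoiders_def)

lemma avoiders_subset: "avoiders N n \<subseteq> Vq M q"
  by (auto simp: avoiders_def)

lemma finite_pre_avoiders: "finite (pre k ` avoiders N n)"
  using digits_Vq avoiders_subset by (intro finite_pre_image(1)) blast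

lemma pre_reflect_eqD:
  assumes "digits M y" "pre n (reflect M y) = pre n x" shows "pre n y = pre n (reflect M x)"
  using assms by (metis pre_reflect reflect_reflect)

text \<open>Every comparison of a tail of \<open>x\<close> with \<alpha>(q) is decided within
  \<open>N\<close> digits, and there \<alpha>(p) agrees with \<alpha>(q).\<close>

lemma avoiding_in_Vq:
  assumes p: "1 < p" "p < q" "pre N (quasi_greedy M p) = pre N \<alpha>" and x: "\<And>n. x \<in> avoiders N n"
  shows "x \<in> Vq M p"
proof -
  interpret p: expansion_base M p using p q_le by unfold_locales auto
  have V: "x \<in> Vq M q" using x avoiders_subset by blast
  have av: "pre N (shift i x) \<noteq> pre N \<alpha>" "pre N (shift i x) \<noteq> pre N (reflect M \<alpha>)" for i
    using x[of "i + N"] by (auto simp: avoiders_def)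
  have "pre N (shift i (reflect M x)) \<noteq> pre N \<alpha>" for i
    using av(2)[of i] pre_reflect_eqD[OF digits_shift[OF digits_Vq[OF V], of i], of N \<alpha>] by (auto simp: shift_reflect)
  then have "lex_less (shift i (reflect M x)) p.\<alpha>" "lex_less (shift i x) p.\<alpha>" for i
    using V av(1) by (auto simp: Vq_iff intro!: lex_less_of_pre[OF _ _ refl p(3)])
  then show ?thesis using digits_Vq[OF V] by (simp add: p.Vq_iff lex_le_def)
qed

text \<open>Long words avoiding the first \<open>N\<close> digits of \<open>\<alpha>\<close> and their reflection begin, by compactness,
  like sequences that avoid them altogether, and these belong to a subshift of smaller entropy.\<close>

lemma avoiders_weight_bounded:
  "\<exists>K\<ge>0. \<forall>T. (\<Sum>n<T. real (card (pre n ` avoiders N n)) * z ^ n) \<le> K"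
proof -
  obtain p where p: "1 < p" "p < q" "pre N (quasi_greedy M p) = pre N \<alpha>"
    using quasi_greedy_left_continuous[OF q_gt_1 q_le] by blast
  interpret p: expansion_base M p using p q_le by unfold_locales auto
  have "\<forall>\<^sub>F m in sequentially. ln (real (card (pre m ` Vq M p))) / real m < entropy M q"
    using p.entropy_tendsto entropy_increase[OF p(1,2)] by (rule order_tendstoD)
  from eventually_happens'[OF sequentially_bot eventually_conj[OF eventually_ge_at_top[of 1] this]]
  obtain m where m: "m \<ge> 1" "ln (real (card (pre m ` Vq M p))) / real m < entropy M q" by blast
  define b where "b = card (pre m ` Vq M p)"
  \<comment> \<open>At a single length \<open>m\<close> the smaller base has fewer than
    \<open>exp (m H(q))\<close> words; this is the contraction factor per \<open>m\<close>
    digits.\<close>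
  have small: "real b * z ^ m < 1"
  proof (cases "b = 0")
    case False
    have "ln (real b) < real m * entropy M q" using m by (simp add: b_def field_simps)
    then have "exp (ln (real b)) < exp (real m * entropy M q)" by (simp only: exp_less_cancel_iff)
    then have "real b < exp (real m * entropy M q)" using False by simp
    then have "real b * z ^ m < exp (real m * entropy M q) * z ^ m" using z_pos by simp
    also have "\<dots> = 1" by (simp add: z_power exp_minus)
    finally show ?thesis .
  qed simp
  have "\<exists>n0. \<forall>x\<in>avoiders N n0. pre m x \<in> pre m ` Vq M p"
  proof (rule ccontr)
    assume "\<not> ?thesis"
    then obtain f where f: "\<And>n. f n \<in> avoiders N n" "\<And>n. pre m (f n) \<notin> pre m ` Vq M p" by metis
    have fV: "f n \<in> Vq M q" for n using f(1) avoiders_subset by blast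
    obtain x where x: "\<And>k. infinite {n. pre k (f n) = pre k x}"
      using full_shift_accumulation[of M f] digits_Vq[OF fV] by blast
    have x': "\<exists>n\<ge>k. pre k (f n) = pre k x" for k
      using x[of k] by (auto simp: infinite_nat_iff_unbounded_le)
    have "digits M x"
      unfolding digits_def using x' digits_Vq[OF fV] by (metis digits_def lessI pre_eqD)
    then have xV: "x \<in> Vq M q" using x' fV by (intro Vq_closed) blast+
    have "x \<in> avoiders N n" for n
    proof -
      obtain j where j: "j \<ge> n" "pre n (f j) = pre n x" using x' by blast
      have "f j \<in> avoiders N n" using f(1) j(1) avoiders_antimono by blast
      moreover have "pre N (shift i (f j)) = pre N (shift i x)" if "i + N \<le> n" for i
        using pre_eq_mono[OF j(2) that] by (rule pre_shift_cong)
      ultimately show ?thesis using xV by (simp add: avoiders_def)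
    qed
    then have "x \<in> Vq M p" using avoiding_in_Vq[OF p] by blast
    moreover obtain j where "pre m (f j) = pre m x" using x' by blast
    ultimately show False using f(2) by (metis image_eqI)
  qed
  then obtain n0 where n0: "\<And>x. x \<in> avoiders N n0 \<Longrightarrow> pre m x \<in> pre m ` Vq M p" by blast
  \<comment> \<open>Digits are split off at the front: the first \<open>m\<close> have at most
    \<open>b\<close> patterns since \<open>n \<ge> n0\<close>, and the rest still avoids both
    words.\<close>
  have step: "card (pre (n + m) ` avoiders N (n + m)) \<le> b * card (pre n ` avoiders N n)" if "n \<ge> n0" for n
  proof -
    have "pre (m + n) ` avoiders N (m + n) \<subseteq> (\<lambda>(u, v). u @ v) ` (pre m ` Vq M p \<times> pre n ` avoiders N n)"
    proof
      fix w assume "w \<in> pre (m + n) ` avoiders N (m + n)"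
      then obtain x where x: "x \<in> avoiders N (m + n)" "w = pre m x @ pre n (shift m x)" by (auto simp: pre_add)
      have "x \<in> avoiders N n0" using x(1) avoiders_antimono[of n0 "m + n"] that by auto
      then have "(pre m x, pre n (shift m x)) \<in> pre m ` Vq M p \<times> pre n ` avoiders N n"
        using n0 avoiders_shift[OF x(1)] by auto
      then show "w \<in> (\<lambda>(u, v). u @ v) ` (pre m ` Vq M p \<times> pre n ` avoiders N n)" using x(2) by force
    qed
    then have "card (pre (m + n) ` avoiders N (m + n)) \<le> card (pre m ` Vq M p \<times> pre n ` avoiders N n)"
      using p.finite_words_Vq finite_pre_avoiders
      by (meson card_image_le card_mono finite_SigmaI finite_imageI order_trans)
    then show ?thesis by (simp add: card_cartesian_product b_def add.commute)
  qed
  show ?thesis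
  proof (rule delayed_contraction_summable[of _ "real b * z ^ m" n0 m])
    fix n assume "n \<ge> n0"
    have "real (card (pre (n + m) ` avoiders N (n + m))) \<le> real (b * card (pre n ` avoiders N n))"
      using step[OF \<open>n \<ge> n0\<close>] by (simp only: of_nat_le_iff)
    then have "real (card (pre (n + m) ` avoiders N (n + m))) * z ^ (n + m)
        \<le> real (b * card (pre n ` avoiders N n)) * z ^ (n + m)"
      using z_pos by (intro mult_right_mono) auto
    then show "real (card (pre (n + m) ` avoiders N (n + m))) * z ^ (n + m)
        \<le> real b * z ^ m * (real (card (pre n ` avoiders N n)) * z ^ n)"
      by (simp add: power_add ac_simps)
  qed (use small z_pos in auto)
qed

section \<open>Splitting words at the first occurrence of the prefix\<close>

lemma followers_reflect: "followers (pre N (reflect M \<alpha>)) = reflect M ` followers (pre N \<alpha>)"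
proof -
  have *: "cat (pre N (reflect M x)) (reflect M y) \<in> Vq M q" if "cat (pre N x) y \<in> Vq M q" for x y
    using reflect_Vq[OF that] by (simp add: reflect_cat pre_reflect)
  show ?thesis
  proof (intro equalityI subsetI)
    fix y assume y: "y \<in> followers (pre N (reflect M \<alpha>))"
    then have "reflect M y \<in> followers (pre N \<alpha>)" using *[of "reflect M \<alpha>" y] by (simp add: followers_def)
    then show "y \<in> reflect M ` followers (pre N \<alpha>)" using digits_followers[OF y] by (metis image_eqI reflect_reflect)
  qed (use * in \<open>auto simp: followers_def\<close>)
qed

lemma count_reflect: "count (pre N (reflect M \<alpha>)) n = count (pre N \<alpha>) n"
proof -
  have "pre n ` followers (pre N (reflect M \<alpha>)) = map (\<lambda>d. M - d) ` pre n ` followers (pre N \<alpha>)"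
    by (simp only: followers_reflect image_image) (simp only: pre_reflect)
  moreover have "inj_on (map (\<lambda>d. M - d)) (pre n ` followers (pre N \<alpha>))"
  proof (rule inj_on_inverseI[of _ "map (\<lambda>d. M - d)"])
    fix w assume "w \<in> pre n ` followers (pre N \<alpha>)"
    then have "set w \<subseteq> {..M}" using set_pre digits_followers by blast
    then show "map (\<lambda>d. M - d) (map (\<lambda>d. M - d) w) = w" by (auto intro!: map_idI)
  qed
  ultimately show ?thesis by (simp add: count_def card_image)
qed

text \<open>At a first occurrence at \<open>i\<close>, the word is an avoiding word of length
  \<open>i\<close>, then the block, then a word following the block. Avoidance concerns only windows
  inside the first \<open>i\<close> digits, all of which start before \<open>i\<close> because
  \<open>N \<ge> 1\<close>. The block and its reflection have equally many continuations, whence the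
  factor 2.\<close>

lemma first_occurrence:
  assumes N: "N \<ge> 1"
  shows "count [] n \<le> card (pre n ` avoiders N n)
    + (\<Sum>i<n. if i + N \<le> n then 2 * (card (pre i ` avoiders N i) * count (pre N \<alpha>) (n - (i + N))) else 0)"
proof -
  define A where "A i = pre i ` avoiders N i" for i
  define P where "P b i = (\<lambda>(u, v). u @ b @ v) ` (A i \<times> pre (n - (i + N)) ` followers b)" for b i
  let ?I = "{..<n} \<inter> {i. i + N \<le> n}"
  let ?a = "pre N \<alpha>" and ?b = "pre N (reflect M \<alpha>)"
  have finA: "finite (A i)" for i unfolding A_def by (rule finite_pre_avoiders)
  have finP: "finite (P b i)" for b i unfolding P_def using finA finite_pre_followers by blast
  have cP: "card (P b i) \<le> card (A i) * count b (n - (i + N))" for b i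
    unfolding P_def count_def card_cartesian_product[symmetric]
    using finA finite_pre_followers by (intro card_image_le) blast
  have "pre n ` Vq M q \<subseteq> A n \<union> (\<Union>i\<in>?I. P ?a i \<union> P ?b i)"
  proof
    fix w assume "w \<in> pre n ` Vq M q"
    then obtain x where x: "x \<in> Vq M q" "w = pre n x" by blast
    show "w \<in> A n \<union> (\<Union>i\<in>?I. P ?a i \<union> P ?b i)"
    proof (cases "x \<in> avoiders N n")
      case True
      then show ?thesis using x by (simp add: A_def)
    next
      case False
      define Q where "Q i \<longleftrightarrow> i + N \<le> n \<and> (pre N (shift i x) = ?a \<or> pre N (shift i x) = ?b)" for i
      define i where "i = (LEAST i. Q i)"
      have "\<exists>i. Q i" using False x by (auto simp: avoiders_def Q_def)
      then have Qi: "Q i" unfolding i_def by (rule LeastI_ex)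
      have "x \<in> avoiders N i"
        using x Qi N not_less_Least[of _ Q, folded i_def] by (auto simp: avoiders_def Q_def)
      then have "pre i x \<in> A i" by (simp add: A_def)
      moreover obtain b where b: "b = ?a \<or> b = ?b" "pre N (shift i x) = b" using Qi by (auto simp: Q_def)
      moreover have "shift (i + N) x \<in> followers b"
      proof -
        have "cat b (shift N (shift i x)) = shift i x" unfolding b(2)[symmetric] by (rule cat_pre_shift)
        then show ?thesis using shift_Vq[OF x(1), of i] by (simp add: followers_def add.commute)
      qed
      moreover have "w = pre i x @ b @ pre (n - (i + N)) (shift (i + N) x)"
      proof -
        have "n = i + (N + (n - (i + N)))" using Qi by (simp add: Q_def)
        then have "w = pre i x @ pre (N + (n - (i + N))) (shift i x)" using x(2) pre_add by metis
        then show ?thesis using b(2) by (simp add: pre_add add.commute)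
      qed
      ultimately have "w \<in> P b i" unfolding P_def by force
      then show ?thesis using b(1) Qi N by (auto simp: Q_def)
    qed
  qed
  then have "count [] n \<le> card (A n \<union> (\<Union>i\<in>?I. P ?a i \<union> P ?b i))"
    unfolding count_def followers_Nil using finA finP by (intro card_mono) auto
  also have "\<dots> \<le> card (A n) + (\<Sum>i\<in>?I. card (P ?a i) + card (P ?b i))"
  proof (rule order_trans[OF card_Un_le add_left_mono])
    have "card (\<Union>i\<in>?I. P ?a i \<union> P ?b i) \<le> (\<Sum>i\<in>?I. card (P ?a i \<union> P ?b i))" by (rule card_UN_le) simp
    also have "\<dots> \<le> (\<Sum>i\<in>?I. card (P ?a i) + card (P ?b i))" by (intro sum_mono card_Un_le)
    finally show "card (\<Union>i\<in>?I. P ?a i \<union> P ?b i) \<le> (\<Sum>i\<in>?I. card (P ?a i) + card (P ?b i))" .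
  qed
  also have "\<dots> \<le> card (A n) + (\<Sum>i\<in>?I. 2 * (card (A i) * count ?a (n - (i + N))))"
    using cP[of ?a] cP[of ?b] by (intro add_left_mono sum_mono) (metis add_mono count_reflect mult_2)
  also have "(\<Sum>i\<in>?I. 2 * (card (A i) * count ?a (n - (i + N)))) =
      (\<Sum>i<n. if i + N \<le> n then 2 * (card (A i) * count ?a (n - (i + N))) else 0)"
    by (subst sum.inter_restrict) (auto intro: sum.cong)
  finally show ?thesis unfolding A_def .
qed

text \<open>The splitting is a convolution. Its first factor has bounded total weight
  \<open>K\<close>, so multiplying by the sum for the block costs only a constant; the weight
  \<open>z ^ N\<close> of the block is bounded by 1.\<close>

lemma wsum_prefix_comparable:
  assumes N: "N \<ge> 1"
  shows "\<exists>C>0. \<forall>T. wsum [] T \<le> C * (1 + wsum (pre N \<alpha>) T)"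
proof -
  define A where "A i = real (card (pre i ` avoiders N i))" for i
  define g where "g k = real (count (pre N \<alpha>) k) * z ^ k" for k
  obtain K where K: "K \<ge> 0" "\<And>T. (\<Sum>n<T. A n * z ^ n) \<le> K"
    using avoiders_weight_bounded unfolding A_def by blast
  have g0: "0 \<le> g k" for k using z_pos by (simp add: g_def)
  have A0: "0 \<le> A k * z ^ k" for k using z_pos by (simp add: A_def)
  have "wsum [] T \<le> K + 2 * K * wsum (pre N \<alpha>) T" for T
  proof -
    have "real (count [] n) * z ^ n \<le> A n * z ^ n
        + (\<Sum>i<T. 2 * (A i * z ^ i) * (if i + N \<le> n then g (n - (i + N)) else 0))" if n: "n < T" for n
    proof -
      have "real (count [] n) * z ^ n \<le> (A n
          + (\<Sum>i<n. if i + N \<le> n then 2 * (A i * real (count (pre N \<alpha>) (n - (i + N)))) else 0)) * z ^ n"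
      proof (intro mult_right_mono)
        have "real (count [] n) \<le> real (card (pre n ` avoiders N n)
            + (\<Sum>i<n. if i + N \<le> n then 2 * (card (pre i ` avoiders N i) * count (pre N \<alpha>) (n - (i + N))) else 0))"
          using first_occurrence[OF N, of n] by (simp only: of_nat_le_iff)
        then show "real (count [] n) \<le> A n
            + (\<Sum>i<n. if i + N \<le> n then 2 * (A i * real (count (pre N \<alpha>) (n - (i + N)))) else 0)"
          by (simp add: A_def if_distrib[of real] cong: if_cong)
      qed (use z_pos in simp)
      also have "\<dots> = A n * z ^ n
          + (\<Sum>i<n. (if i + N \<le> n then 2 * (A i * real (count (pre N \<alpha>) (n - (i + N)))) else 0) * z ^ n)"
        by (simp add: distrib_right sum_distrib_right)
      also have "\<dots> \<le> A n * z ^ n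
          + (\<Sum>i<n. 2 * (A i * z ^ i) * (if i + N \<le> n then g (n - (i + N)) else 0))"
      proof (intro add_left_mono sum_mono)
        fix i
        show "(if i + N \<le> n then 2 * (A i * real (count (pre N \<alpha>) (n - (i + N)))) else 0) * z ^ n
          \<le> 2 * (A i * z ^ i) * (if i + N \<le> n then g (n - (i + N)) else 0)"
        proof (cases "i + N \<le> n")
          case True
          have "z ^ n = z ^ i * z ^ (n - (i + N)) * z ^ N" using True by (simp add: power_add[symmetric])
          also have "\<dots> \<le> z ^ i * z ^ (n - (i + N)) * 1"
            using z_pos z_less_1 by (intro mult_left_mono power_le_one) auto
          finally have "2 * (A i * real (count (pre N \<alpha>) (n - (i + N)))) * z ^ n
              \<le> 2 * (A i * real (count (pre N \<alpha>) (n - (i + N)))) * (z ^ i * z ^ (n - (i + N)))"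
            by (intro mult_left_mono) (auto simp: A_def)
          then show ?thesis using True by (simp add: g_def ac_simps)
        qed simp
      qed
      also have "\<dots> \<le> A n * z ^ n
          + (\<Sum>i<T. 2 * (A i * z ^ i) * (if i + N \<le> n then g (n - (i + N)) else 0))"
        using n A0 g0 by (intro add_left_mono sum_mono2) auto
      finally show ?thesis .
    qed
    then have "wsum [] T \<le> (\<Sum>n<T. A n * z ^ n
        + (\<Sum>i<T. 2 * (A i * z ^ i) * (if i + N \<le> n then g (n - (i + N)) else 0)))"
      unfolding wsum_def by (intro sum_mono) auto
    also have "\<dots> = (\<Sum>n<T. A n * z ^ n)
        + (\<Sum>n<T. \<Sum>i<T. 2 * (A i * z ^ i) * (if i + N \<le> n then g (n - (i + N)) else 0))"
      by (rule sum.distrib)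
    also have "(\<Sum>n<T. \<Sum>i<T. 2 * (A i * z ^ i) * (if i + N \<le> n then g (n - (i + N)) else 0))
      = (\<Sum>i<T. 2 * (A i * z ^ i) * (\<Sum>n<T. if i + N \<le> n then g (n - (i + N)) else 0))"
      by (subst sum.swap) (simp only: sum_distrib_left)
    also have "\<dots> \<le> (\<Sum>i<T. 2 * (A i * z ^ i) * (\<Sum>n<T. g n))"
      using A0 g0 by (intro sum_mono mult_left_mono sum_delayed_le) auto
    also have "\<dots> = 2 * (\<Sum>i<T. A i * z ^ i) * wsum (pre N \<alpha>) T"
      by (simp only: wsum_def g_def sum_distrib_right[symmetric] sum_distrib_left[symmetric])
    also have "(\<Sum>n<T. A n * z ^ n) + \<dots> \<le> K + 2 * K * wsum (pre N \<alpha>) T"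
      using K(2)[of T] wsum_nonneg by (intro add_mono mult_right_mono) auto
    finally show ?thesis by simp
  qed
  \<comment> \<open>\<open>2 * K + 1\<close> dominates both coefficients and is positive even if
    \<open>K = 0\<close>.\<close>
  moreover have "K + 2 * K * t \<le> (2 * K + 1) * (1 + t)" if "0 \<le> t" for t
    using K(1) that by (simp add: algebra_simps)
  ultimately have "wsum [] T \<le> (2 * K + 1) * (1 + wsum (pre N \<alpha>) T)" for T
    using wsum_nonneg order_trans by blast
  then show ?thesis using K(1) by (intro exI[of _ "2 * K + 1"]) auto
qed

text \<open>The followers of a word contain those of its longest suffix that is a prefix of \<open>\<alpha>\<close> or of the
  reflection of \<open>\<alpha>\<close>: every longer suffix already differs from both.\<close>

lemma followers_suffix:
  assumes y0: "y0 \<in> followers w"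
  shows "\<exists>k. followers (pre k \<alpha>) \<subseteq> followers w \<or> followers (pre k (reflect M \<alpha>)) \<subseteq> followers w"
proof -
  define Q where "Q j \<longleftrightarrow> j \<le> length w \<and>
    (drop j w = pre (length w - j) \<alpha> \<or> drop j w = pre (length w - j) (reflect M \<alpha>))" for j
  define j where "j = (LEAST j. Q j)"
  have "Q (length w)" by (simp add: Q_def)
  then have Qj: "Q j" unfolding j_def by (rule LeastI)
  have V0: "cat w y0 \<in> Vq M q" using y0 by (simp add: followers_def)
  have dw: "set w \<subseteq> {..M}" using digits_Vq[OF V0] by (simp add: digits_cat)
  have "followers (drop j w) \<subseteq> followers w"
  proof
    fix y assume "y \<in> followers (drop j w)"
    then have V: "cat (drop j w) y \<in> Vq M q" by (simp add: followers_def)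
    have eq: "shift j (cat w y) = cat (drop j w) y" using Qj by (simp add: shift_cat Q_def)
    have d: "digits M (cat w y)" using dw digits_Vq[OF V] by (simp add: digits_cat)
    have "lex_le (shift n (cat w y)) \<alpha> \<and> lex_le (shift n (reflect M (cat w y))) \<alpha>" for n
    \<comment> \<open>For \<open>n < j\<close> the comparison is decided inside \<open>w\<close>,
      and the known continuation \<open>y0\<close> shows that it goes the right way. From
      \<open>j\<close> on, only the suffix and \<open>y\<close> matter.\<close>
    proof (cases "n < j")
      case True
      let ?l = "length w - n"
      have nw: "n \<le> length w" using True Qj by (simp add: Q_def)
      have p: "pre ?l (shift n (cat w x)) = drop n w" for x
        using pre_length_cat[of "drop n w" x] nw by (simp add: shift_cat)
      have p': "pre ?l (shift n (reflect M (cat w x))) = map (\<lambda>d. M - d) (drop n w)" for x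
        by (simp add: shift_reflect pre_reflect p)
      have nQ: "drop n w \<noteq> pre ?l \<alpha>" "drop n w \<noteq> pre ?l (reflect M \<alpha>)"
        using not_less_Least[of n Q, folded j_def] True nw by (auto simp: Q_def)
      have "lex_less (shift n (cat w y)) \<alpha>"
        using V0 nQ(1) by (intro lex_less_of_pre[of "shift n (cat w y0)" \<alpha> ?l]) (auto simp: Vq_iff p)
      moreover have "lex_less (shift n (reflect M (cat w y))) \<alpha>"
      proof (rule lex_less_of_pre[of "shift n (reflect M (cat w y0))" \<alpha> ?l])
        show "lex_le (shift n (reflect M (cat w y0))) \<alpha>" using V0 by (simp add: Vq_iff)
        show "pre ?l (shift n (reflect M (cat w y0))) \<noteq> pre ?l \<alpha>"
          using pre_reflect_eqD[OF digits_shift[OF digits_Vq[OF V0]], of ?l n \<alpha>] nQ(2) p[of y0]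
          by (auto simp: shift_reflect)
      qed (simp_all add: p')
      ultimately show ?thesis by (simp add: lex_le_def)
    next
      case False
      then have "shift n x = shift (n - j) (shift j x)" for x :: "nat \<Rightarrow> nat" by simp
      then show ?thesis using V eq unfolding Vq_iff by (metis shift_reflect)
    qed
    then show "y \<in> followers w" using d by (simp add: followers_def Vq_iff)
  qed
  moreover have "drop j w = pre (length w - j) \<alpha> \<or> drop j w = pre (length w - j) (reflect M \<alpha>)"
    using Qj by (simp add: Q_def)
  ultimately show ?thesis by metis
qed

lemma wsum_comparable:
  assumes "followers w \<noteq> {}"
  shows "\<exists>C>0. \<forall>T. wsum [] T \<le> C * (1 + wsum w T)"
proof -
  obtain y0 where "y0 \<in> followers w" using assms by blast
  then obtain k where "followers (pre k \<alpha>) \<subseteq> followers w \<or> followers (pre k (reflect M \<alpha>)) \<subseteq> followers w"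
    using followers_suffix by blast
  moreover have "wsum (pre k (reflect M \<alpha>)) T = wsum (pre k \<alpha>) T" for T
    by (simp add: wsum_def count_reflect)
  ultimately have le: "wsum (pre k \<alpha>) T \<le> wsum w T" for T using wsum_mono by metis
  have "\<exists>C>0. \<forall>T. wsum [] T \<le> C * (1 + wsum (pre k \<alpha>) T)"
  proof (cases "k = 0")
    case True
    then show ?thesis by (intro exI[of _ 1]) simp
  next
    case False
    then show ?thesis by (intro wsum_prefix_comparable) simp
  qed
  then obtain C where C: "C > 0" "\<And>T. wsum [] T \<le> C * (1 + wsum (pre k \<alpha>) T)" by blast
  have "wsum [] T \<le> C * (1 + wsum w T)" for T
    using C(2)[of T] mult_left_mono[of "1 + wsum (pre k \<alpha>) T" "1 + wsum w T" C] le[of T] C(1) by linarith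
  then show ?thesis using C(1) by blast
qed

text \<open>A long word following \<open>w\<close> begins with some \<open>f i\<close>, and what
  remains is a word of the subshift. Weighting by \<open>z ^ n\<close> turns removal of
  \<open>f i\<close> into the factor \<open>z ^ length (f i)\<close>.\<close>

lemma wsum_cover:
  fixes f :: "nat \<Rightarrow> nat list"
  assumes cover: "followers w \<subseteq> (\<Union>i<k. {y. pre (length (f i)) y = f i})"
  shows "\<exists>K. \<forall>T. wsum w T \<le> K + (\<Sum>i<k. z ^ length (f i)) * wsum [] T"
proof -
  \<comment> \<open>Any common bound on the lengths would do; words shorter than \<open>L\<close> go
    into the constant \<open>G\<close>.\<close>
  define L where "L = (\<Sum>i<k. length (f i))"
  have L: "length (f i) \<le> L" if "i < k" for i unfolding L_def using that by (intro member_le_sum) auto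
  define B where "B n = real (count [] n) * z ^ n" for n
  have B0: "0 \<le> B n" for n using z_pos by (simp add: B_def)
  define G where "G = (\<Sum>n<L. real (count w n) * z ^ n)"
  have "wsum w T \<le> G + (\<Sum>i<k. z ^ length (f i)) * wsum [] T" for T
  proof -
    have "real (count w n) * z ^ n \<le> (if n < L then real (count w n) * z ^ n else 0)
        + (\<Sum>i<k. z ^ length (f i) * (if length (f i) \<le> n then B (n - length (f i)) else 0))" for n
    proof (cases "n < L")
      case True
      then show ?thesis using z_pos B0 by (auto intro!: sum_nonneg)
    next
      case False
      have "pre n ` followers w \<subseteq> (\<Union>i<k. (\<lambda>r. f i @ r) ` pre (n - length (f i)) ` Vq M q)"
      proof
        fix v assume "v \<in> pre n ` followers w"
        then obtain y where y: "y \<in> followers w" "v = pre n y" by blast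
        then obtain i where i: "i < k" "pre (length (f i)) y = f i" using cover by blast
        have "v = f i @ pre (n - length (f i)) (shift (length (f i)) y)"
          using pre_add[of "length (f i)" "n - length (f i)" y] L[OF i(1)] False y i(2) by simp
        moreover have "shift (length (f i)) y \<in> Vq M q" using y(1) followers_subset shift_Vq by blast
        ultimately show "v \<in> (\<Union>i<k. (\<lambda>r. f i @ r) ` pre (n - length (f i)) ` Vq M q)" using i(1) by blast
      qed
      then have "count w n \<le> card (\<Union>i<k. (\<lambda>r. f i @ r) ` pre (n - length (f i)) ` Vq M q)"
        unfolding count_def using finite_words_Vq by (intro card_mono) auto
      also have "\<dots> \<le> (\<Sum>i<k. card ((\<lambda>r. f i @ r) ` pre (n - length (f i)) ` Vq M q))" by (rule card_UN_le) simp
      also have "\<dots> \<le> (\<Sum>i<k. count [] (n - length (f i)))"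
        unfolding count_def followers_Nil using finite_words_Vq by (intro sum_mono card_image_le)
      finally have "real (count w n) \<le> (\<Sum>i<k. real (count [] (n - length (f i))))"
        by (simp only: of_nat_sum[symmetric] of_nat_le_iff)
      then have "real (count w n) * z ^ n \<le> (\<Sum>i<k. real (count [] (n - length (f i)))) * z ^ n"
        using z_pos by (intro mult_right_mono) auto
      also have "\<dots> = (\<Sum>i<k. real (count [] (n - length (f i))) * z ^ n)" by (rule sum_distrib_right)
      also have "\<dots> = (\<Sum>i<k. z ^ length (f i) * (if length (f i) \<le> n then B (n - length (f i)) else 0))"
      proof (rule sum.cong[OF refl])
        fix i assume "i \<in> {..<k}"
        then have "length (f i) \<le> n" using L[of i] False by simp
        then show "real (count [] (n - length (f i))) * z ^ n
            = z ^ length (f i) * (if length (f i) \<le> n then B (n - length (f i)) else 0)"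
          by (simp add: B_def power_add[symmetric])
      qed
      finally show ?thesis using False by simp
    qed
    then have "wsum w T \<le> (\<Sum>n<T. (if n < L then real (count w n) * z ^ n else 0)
        + (\<Sum>i<k. z ^ length (f i) * (if length (f i) \<le> n then B (n - length (f i)) else 0)))"
      unfolding wsum_def by (rule sum_mono)
    also have "\<dots> = (\<Sum>n<T. if n < L then real (count w n) * z ^ n else 0)
        + (\<Sum>n<T. \<Sum>i<k. z ^ length (f i) * (if length (f i) \<le> n then B (n - length (f i)) else 0))"
      by (rule sum.distrib)
    also have "(\<Sum>n<T. \<Sum>i<k. z ^ length (f i) * (if length (f i) \<le> n then B (n - length (f i)) else 0))
        = (\<Sum>i<k. z ^ length (f i) * (\<Sum>n<T. if length (f i) \<le> n then B (n - length (f i)) else 0))"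
      by (subst sum.swap) (simp only: sum_distrib_left)
    also have "\<dots> \<le> (\<Sum>i<k. z ^ length (f i) * (\<Sum>n<T. B n))"
      using z_pos B0 by (intro sum_mono mult_left_mono sum_delayed_le) auto
    also have "\<dots> = (\<Sum>i<k. z ^ length (f i)) * wsum [] T"
      by (simp add: wsum_def B_def sum_distrib_right)
    also have "(\<Sum>n<T. if n < L then real (count w n) * z ^ n else 0) \<le> G"
    proof -
      have "(\<Sum>n<T. if n < L then real (count w n) * z ^ n else 0)
          = (\<Sum>n\<in>{..<T} \<inter> {n. n < L}. real (count w n) * z ^ n)" by (simp add: sum.inter_restrict)
      also have "\<dots> \<le> G" unfolding G_def using z_pos by (intro sum_mono2) auto
      finally show ?thesis .
    qed
    finally show ?thesis by simp
  qed
  then show ?thesis by blast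
qed

text \<open>Compactness: sequences escaping the first \<open>k\<close> cylinders would accumulate at
  a follower of \<open>w\<close>, which lies in some cylinder, and that cylinder would then contain
  late members of the sequence.\<close>

lemma followers_finite_subcover:
  fixes f :: "nat \<Rightarrow> nat list"
  assumes cover: "followers w \<subseteq> (\<Union>i. {y. pre (length (f i)) y = f i})"
  shows "\<exists>k. followers w \<subseteq> (\<Union>i<k. {y. pre (length (f i)) y = f i})"
proof (rule ccontr)
  assume "\<not> ?thesis"
  then have "\<forall>k. \<exists>y. y \<in> followers w \<and> (\<forall>i<k. pre (length (f i)) y \<noteq> f i)" by blast
  then obtain g where g: "\<And>k. g k \<in> followers w" "\<And>k i. i < k \<Longrightarrow> pre (length (f i)) (g k) \<noteq> f i" by metis
  obtain x where x: "\<And>m. infinite {n. pre m (g n) = pre m x}"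
    using full_shift_accumulation[of M g] digits_followers[OF g(1)] by blast
  have x': "\<exists>n\<ge>k. pre m (g n) = pre m x" for k m
    using x[of m] by (auto simp: infinite_nat_iff_unbounded_le)
  have "x \<in> followers w"
    unfolding followers_def
  proof (intro CollectI Vq_closed)
    have gV: "cat w (g n) \<in> Vq M q" for n using g(1) by (simp add: followers_def)
    have "digits M x"
      unfolding digits_def using x' digits_followers[OF g(1)] by (metis digits_def lessI pre_eqD)
    then show "digits M (cat w x)" using digits_Vq[OF gV] by (simp add: digits_cat)
    fix n
    obtain j where "pre n (g j) = pre n x" using x' by blast
    then have "pre n (cat w (g j)) = pre n (cat w x)" by (auto simp: pre_eq_iff cat_def)
    then show "\<exists>v\<in>Vq M q. pre n v = pre n (cat w x)" using gV by blast
  qed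
  then obtain i where "pre (length (f i)) x = f i" using cover by blast
  moreover obtain n where "n \<ge> Suc i" "pre (length (f i)) (g n) = pre (length (f i)) x" using x' by blast
  ultimately show False using g(2)[of i n] by simp
qed

text \<open>With \<open>S = wsum [] T\<close> and total cover weight \<sigma>, comparison gives
  \<open>S \<le> C (1 + K + \<sigma> S)\<close>. As \<open>S \<ge> T\<close> is unbounded,
  \<open>C \<sigma> \<ge> 1\<close>. The constant \<open>K\<close> depends on the cover but
  disappears, leaving \<open>1 / C\<close>, which depends on \<open>w\<close> alone.\<close>

lemma followers_cover_weight:
  assumes "followers w \<noteq> {}"
  shows "\<exists>c>0. \<forall>f :: nat \<Rightarrow> nat list. followers w \<subseteq> (\<Union>i. {y. pre (length (f i)) y = f i})
    \<longrightarrow> (\<exists>k. c \<le> (\<Sum>i<k. z ^ length (f i)))"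
proof -
  obtain C where C: "C > 0" "\<And>T. wsum [] T \<le> C * (1 + wsum w T)" using wsum_comparable[OF assms] by blast
  have "\<exists>k. 1 / C \<le> (\<Sum>i<k. z ^ length (f i))"
    if f: "followers w \<subseteq> (\<Union>i. {y. pre (length (f i)) y = f i})" for f :: "nat \<Rightarrow> nat list"
  proof -
    obtain k where k: "followers w \<subseteq> (\<Union>i<k. {y. pre (length (f i)) y = f i})"
      using followers_finite_subcover[OF f] by blast
    obtain K where K: "\<And>T. wsum w T \<le> K + (\<Sum>i<k. z ^ length (f i)) * wsum [] T" using wsum_cover[OF k] by blast
    define \<sigma> where "\<sigma> = (\<Sum>i<k. z ^ length (f i))"
    have "1 / C \<le> \<sigma>"
    proof (rule ccontr)
      assume "\<not> ?thesis"
      then have d: "0 < 1 - C * \<sigma>" using C(1) by (simp add: field_simps)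
      have "real T * (1 - C * \<sigma>) \<le> C * (1 + K)" for T
      proof -
        have "wsum [] T \<le> C * (1 + (K + \<sigma> * wsum [] T))"
          using C(2)[of T] mult_left_mono[of "1 + wsum w T" "1 + (K + \<sigma> * wsum [] T)" C] K[of T] C(1)
          unfolding \<sigma>_def by linarith
        then have "wsum [] T * (1 - C * \<sigma>) \<le> C * (1 + K)" by (simp add: algebra_simps)
        moreover have "real T * (1 - C * \<sigma>) \<le> wsum [] T * (1 - C * \<sigma>)"
          using wsum_Nil_ge d by (intro mult_right_mono) auto
        ultimately show ?thesis by linarith
      qed
      then have "real T \<le> C * (1 + K) / (1 - C * \<sigma>)" for T using d by (simp add: le_divide_eq)
      then show False using reals_Archimedean2 not_le by metis
    qed
    then show ?thesis unfolding \<sigma>_def by blast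
  qed
  then show ?thesis using C(1) by (intro exI[of _ "1 / C"]) auto
qed

end

section \<open>Hausdorff null sets\<close>

lemma hausdorff_null_cover:
  assumes "hausdorff_measure s A = 0" "0 < \<delta>" "0 < e"
  shows "\<exists>C. A \<subseteq> (\<Union>i :: nat. C i) \<and> (\<forall>i. bounded (C i) \<and> diameter (C i) \<le> \<delta>)
    \<and> (\<Sum>i. ennreal (diameter (C i) powr s)) < ennreal e"
proof -
  have "hausdorff_premeasure s \<delta> A \<le> hausdorff_measure s A"
    unfolding hausdorff_measure_def using assms(2) by (intro SUP_upper) auto
  then have "hausdorff_premeasure s \<delta> A < ennreal e" using assms by (simp add: ennreal_zero_less_divide)
  then show ?thesis unfolding hausdorff_premeasure_def by (auto simp: INF_less_iff)
qed

lemma hausdorff_nullI: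
  assumes "\<And>\<delta> e. 0 < \<delta> \<Longrightarrow> 0 < e \<Longrightarrow> \<exists>C. A \<subseteq> (\<Union>i :: nat. C i)
    \<and> (\<forall>i. bounded (C i) \<and> diameter (C i) \<le> \<delta>) \<and> (\<Sum>i. ennreal (diameter (C i) powr s)) \<le> ennreal e"
  shows "hausdorff_measure s A = 0"
proof -
  have "hausdorff_premeasure s \<delta> A \<le> 0" if d: "0 < \<delta>" for \<delta>
  proof (rule ennreal_le_epsilon)
    fix e :: real assume "0 < e"
    then obtain C where C: "A \<subseteq> (\<Union>i :: nat. C i)" "\<forall>i. bounded (C i) \<and> diameter (C i) \<le> \<delta>"
      "(\<Sum>i. ennreal (diameter (C i) powr s)) \<le> ennreal e" using assms[OF d] by blast
    then have "hausdorff_premeasure s \<delta> A \<le> (\<Sum>i. ennreal (diameter (C i) powr s))"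
      unfolding hausdorff_premeasure_def by (intro INF_lower) auto
    then show "hausdorff_premeasure s \<delta> A \<le> 0 + ennreal e" using C(3) by simp
  qed
  then show ?thesis unfolding hausdorff_measure_def by (simp add: SUP_eq_iff bot_ennreal le_zero_eq SUP_le_iff order_antisym)
qed

lemma hausdorff_null_subset:
  assumes "hausdorff_measure s B = 0" "A \<subseteq> B" shows "hausdorff_measure s A = 0"
  by (rule hausdorff_nullI) (use hausdorff_null_cover[OF assms(1)] assms(2) in \<open>meson order_trans less_imp_le\<close>)

lemma hausdorff_null_UN:
  fixes A :: "nat \<Rightarrow> 'a::metric_space set"
  assumes "\<And>n. hausdorff_measure s (A n) = 0"
  shows "hausdorff_measure s (\<Union>n. A n) = 0"
proof (rule hausdorff_nullI)
  fix \<delta> e :: real assume "0 < \<delta>" "0 < e"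
  then have "\<exists>C. A n \<subseteq> (\<Union>i :: nat. C i) \<and> (\<forall>i. bounded (C i) \<and> diameter (C i) \<le> \<delta>)
    \<and> (\<Sum>i. ennreal (diameter (C i) powr s)) < ennreal (e * (1 / 2) ^ Suc n)" for n
    using assms by (intro hausdorff_null_cover) auto
  then obtain C where C: "\<And>n. A n \<subseteq> (\<Union>i :: nat. C n i)" "\<And>n i. bounded (C n i) \<and> diameter (C n i) \<le> \<delta>"
    "\<And>n. (\<Sum>i. ennreal (diameter (C n i) powr s)) < ennreal (e * (1 / 2) ^ Suc n)" by metis
  define D where "D k = (case prod_decode k of (n, i) \<Rightarrow> C n i)" for k
  have "(\<Union>n. A n) \<subseteq> (\<Union>k. D k)"
  proof
    fix x assume "x \<in> (\<Union>n. A n)"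
    then obtain n i where "x \<in> C n i" using C(1) by blast
    then have "x \<in> D (prod_encode (n, i))" by (simp add: D_def)
    then show "x \<in> (\<Union>k. D k)" by blast
  qed
  moreover have "(\<Sum>k. ennreal (diameter (D k) powr s)) \<le> ennreal e"
  proof -
    have "(\<Sum>k. ennreal (diameter (D k) powr s))
        = (\<Sum>k. (\<lambda>(n, i). ennreal (diameter (C n i) powr s)) (prod_decode k))"
      unfolding D_def by (intro suminf_cong) (simp split: prod.split)
    also have "\<dots> = (\<Sum>n. \<Sum>i. ennreal (diameter (C n i) powr s))"
      by (rule suminf_ennreal_2dimen) simp
    also have "\<dots> \<le> (\<Sum>n. ennreal (e * (1 / 2) ^ Suc n))"
      using C(3) by (intro suminf_le) (auto simp: less_imp_le)
    also have "\<dots> = ennreal (e * 1)"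
      using \<open>0 < e\<close> by (intro suminf_ennreal_eq sums_mult power_half_series) auto
    finally show ?thesis by simp
  qed
  ultimately show "\<exists>D. (\<Union>n. A n) \<subseteq> (\<Union>k :: nat. D k) \<and> (\<forall>k. bounded (D k) \<and> diameter (D k) \<le> \<delta>)
    \<and> (\<Sum>k. ennreal (diameter (D k) powr s)) \<le> ennreal e"
    using C(2) by (intro exI[of _ D]) (auto simp: D_def split: prod.split)
qed

lemma hausdorff_null_finite_covers:
  fixes A :: "'a::metric_space set"
  assumes "\<And>\<delta> e. 0 < \<delta> \<Longrightarrow> 0 < e \<Longrightarrow> \<exists>(F :: 'i set) C. finite F \<and> A \<subseteq> (\<Union>i\<in>F. C i)
    \<and> (\<forall>i\<in>F. bounded (C i) \<and> diameter (C i) \<le> \<delta>) \<and> (\<Sum>i\<in>F. diameter (C i) powr s) \<le> e"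
  shows "hausdorff_measure s A = 0"
proof (rule hausdorff_nullI)
  fix \<delta> e :: real assume pos: "0 < \<delta>" "0 < e"
  obtain F and C :: "'i \<Rightarrow> 'a set" where F: "finite F" "A \<subseteq> (\<Union>i\<in>F. C i)" "\<And>i. i \<in> F \<Longrightarrow> bounded (C i) \<and> diameter (C i) \<le> \<delta>"
    "(\<Sum>i\<in>F. diameter (C i) powr s) \<le> e"
    using assms[OF pos] by blast
  obtain h where h: "bij_betw h {..<card F} F"
    using ex_bij_betw_nat_finite[OF F(1)] by (metis atLeast0LessThan)
  \<comment> \<open>Padding by empty sets is free: their diameter is 0, and
    \<open>0 powr s = 0\<close> for every \<open>s\<close>, including 0.\<close>
  define D where "D i = (if i < card F then C (h i) else {})" for i
  have hF: "h i \<in> F" if "i < card F" for i using h that by (auto simp: bij_betw_def)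
  have "A \<subseteq> (\<Union>i. D i)"
  proof
    fix x assume "x \<in> A"
    then obtain j where j: "j \<in> F" "x \<in> C j" using F(2) by blast
    then have "j \<in> h ` {..<card F}" using h by (simp add: bij_betw_def)
    then obtain i where "i < card F" "h i = j" by auto
    then have "x \<in> D i" using j by (simp add: D_def)
    then show "x \<in> (\<Union>i. D i)" by blast
  qed
  moreover have "bounded (D i) \<and> diameter (D i) \<le> \<delta>" for i
    using F(3) hF pos by (auto simp: D_def)
  moreover have "(\<Sum>i. ennreal (diameter (D i) powr s)) \<le> ennreal e"
  proof -
    have "(\<Sum>i. ennreal (diameter (D i) powr s)) = (\<Sum>i<card F. ennreal (diameter (D i) powr s))"
      by (rule suminf_finite) (auto simp: D_def)
    also have "\<dots> = ennreal (\<Sum>i<card F. diameter (C (h i)) powr s)"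
      by (simp add: D_def sum_ennreal)
    also have "(\<Sum>i<card F. diameter (C (h i)) powr s) = (\<Sum>i\<in>F. diameter (C i) powr s)"
      by (rule sum.reindex_bij_betw[OF h])
    finally show ?thesis using F(4) by (simp add: ennreal_leI)
  qed
  ultimately show "\<exists>D. A \<subseteq> (\<Union>i :: nat. D i) \<and> (\<forall>i. bounded (D i) \<and> diameter (D i) \<le> \<delta>)
    \<and> (\<Sum>i. ennreal (diameter (D i) powr s)) \<le> ennreal e" by blast
qed

text \<open>Holds even for \<open>s = 0\<close>, by the convention
  \<open>0 powr 0 = 0\<close>.\<close>

lemma hausdorff_null_singleton: "hausdorff_measure s {x} = 0"
proof (rule hausdorff_null_finite_covers)
  fix \<delta> e :: real assume "0 < \<delta>" "0 < e"
  then have "finite {()} \<and> {x} \<subseteq> (\<Union>i\<in>{()}. {x})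
    \<and> (\<forall>i\<in>{()}. bounded {x} \<and> diameter {x} \<le> \<delta>) \<and> (\<Sum>i\<in>{()}. diameter {x} powr s) \<le> e" by simp
  then show "\<exists>(F :: unit set) C. finite F \<and> {x} \<subseteq> (\<Union>i\<in>F. C i)
    \<and> (\<forall>i\<in>F. bounded (C i) \<and> diameter (C i) \<le> \<delta>) \<and> (\<Sum>i\<in>F. diameter (C i) powr s) \<le> e"
    by (rule exI[of _ "{()}", OF exI[of _ "\<lambda>_. {x}"]])
qed

lemma hausdorff_dim_eqI:
  assumes "0 \<le> d" "\<And>t. d < t \<Longrightarrow> hausdorff_measure t A = 0"
    and "\<And>t. 0 \<le> t \<Longrightarrow> t < d \<Longrightarrow> hausdorff_measure t A \<noteq> 0"
  shows "hausdorff_dim A = d"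
  unfolding hausdorff_dim_def
proof (rule antisym)
  let ?S = "{s. 0 \<le> s \<and> hausdorff_measure s A = 0}"
  show "Inf ?S \<le> d"
  proof (rule field_le_epsilon)
    fix e :: real assume "0 < e"
    then show "Inf ?S \<le> d + e" using assms(1,2) by (intro cInf_lower bdd_belowI[of _ 0]) auto
  qed
  have "d + 1 \<in> ?S" using assms(1,2) by auto
  moreover have "d \<le> t" if "t \<in> ?S" for t using assms(3) that not_le by blast
  ultimately show "d \<le> Inf ?S" by (intro cInf_greatest) auto
qed

section \<open>The upper bound for the dimension\<close>

context expansion_base
begin

lemma proj_cat:
  assumes "digits M (cat w x)" shows "proj q (cat w x) = psum q (cat w x) (length w) + proj q x / q ^ length w"
  using proj_split[OF q_gt_1 assms, of "length w"] by simp

text \<open>For \<open>h\<close> strictly between \<open>H(q)\<close> and \<open>t ln q\<close>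
  there are eventually at most \<open>exp (n h)\<close> words, so the weight decays like
  \<open>exp (n (h - t ln q))\<close>.\<close>

lemma cylinder_weight_tendsto_0:
  assumes t: "entropy M q / ln q < t" and K: "0 \<le> K"
  shows "(\<lambda>n. real (card (pre n ` Vq M q)) * (K / q ^ n) powr t) \<longlonglongrightarrow> 0"
proof -
  have lq: "0 < ln q" using q_gt_1 by simp
  then have "entropy M q < t * ln q" using t by (simp add: divide_less_eq)
  then obtain h where h: "entropy M q < h" "h < t * ln q" using dense by blast
  define r where "r = exp (h - t * ln q)"
  have r: "0 < r" "r < 1" using h by (auto simp: r_def)
  have "\<forall>\<^sub>F n in sequentially. ln (real (card (pre n ` Vq M q))) / real n < h"
    using entropy_tendsto h(1) by (rule order_tendstoD)
  then have up: "\<forall>\<^sub>F n in sequentially. real (card (pre n ` Vq M q)) * (K / q ^ n) powr t \<le> K powr t * r ^ n"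
    using eventually_ge_at_top[of 1]
  proof eventually_elim
    case (elim n)
    let ?N = "real (card (pre n ` Vq M q))"
    have "?N \<le> exp (real n * h)"
    proof (cases "?N = 0")
      case False
      have "ln ?N \<le> real n * h" using elim by (simp add: field_simps)
      then have "exp (ln ?N) \<le> exp (real n * h)" by (simp only: exp_le_cancel_iff)
      then show ?thesis using False by simp
    qed simp
    moreover have "(K / q ^ n) powr t = K powr t * exp (- (real n * (t * ln q)))"
    proof -
      have "(q ^ n) powr t = exp (real n * (t * ln q))"
        using q_gt_1 by (simp add: powr_def ln_realpow)
      moreover have "(K / q ^ n) powr t = K powr t / (q ^ n) powr t"
        using q_gt_1 K by (simp add: powr_divide)
      ultimately show ?thesis by (simp add: exp_minus divide_inverse)
    qed
    ultimately have "?N * (K / q ^ n) powr t \<le> exp (real n * h) * (K powr t * exp (- (real n * (t * ln q))))"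
      by (simp add: mult_right_mono)
    also have "\<dots> = K powr t * r ^ n"
      by (simp add: r_def exp_of_nat_mult[symmetric] mult_exp_exp algebra_simps)
    finally show ?case .
  qed
  have lim: "(\<lambda>n. K powr t * r ^ n) \<longlonglongrightarrow> 0"
    using r by (intro tendsto_mult_right_zero LIMSEQ_power_zero) auto
  have "\<forall>\<^sub>F n in sequentially. 0 \<le> real (card (pre n ` Vq M q)) * (K / q ^ n) powr t"
    by (intro always_eventually allI) simp
  then show ?thesis using up tendsto_const lim by (rule tendsto_sandwich)
qed

lemma hausdorff_null_tail_Vq:
  assumes t: "entropy M q / ln q < t" and w: "set w \<subseteq> {..M}"
  shows "hausdorff_measure t (proj q ` cat w ` Vq M q) = 0"
proof (rule hausdorff_null_finite_covers)
  fix \<delta> e :: real assume pos: "0 < \<delta>" "0 < e"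
  let ?K = "real M / (q - 1)"
  have t0: "0 \<le> t" using t entropy_nonneg q_gt_1 by (meson divide_nonneg_pos less_eq_real_def ln_gt_zero order_trans)
  have d: "digits M (cat w x)" if "x \<in> Vq M q" for x using w digits_Vq[OF that] by (simp add: digits_cat)
  have K0: "0 \<le> ?K" using q_gt_1 by simp
  have "(\<lambda>n. (1 / q) ^ n) \<longlonglongrightarrow> 0" using q_gt_1 by (intro LIMSEQ_power_zero) auto
  from tendsto_mult_right_zero[OF this, of ?K] have "(\<lambda>n. ?K / q ^ n) \<longlonglongrightarrow> 0" by (simp add: power_divide)
  then have "\<forall>\<^sub>F n in sequentially. ?K / q ^ n < \<delta>" using pos by (intro order_tendstoD) auto
  moreover have "\<forall>\<^sub>F n in sequentially. real (card (pre n ` Vq M q)) * (?K / q ^ n) powr t < e"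
    using cylinder_weight_tendsto_0[OF t K0] pos(2) by (rule order_tendstoD)
  ultimately have "\<forall>\<^sub>F n in sequentially. ?K / q ^ n < \<delta> \<and> real (card (pre n ` Vq M q)) * (?K / q ^ n) powr t < e"
    by (rule eventually_conj)
  from eventually_happens'[OF sequentially_bot this] obtain n where
    n: "?K / q ^ n < \<delta>" "real (card (pre n ` Vq M q)) * (?K / q ^ n) powr t < e" by blast
  define C where "C v = proj q ` cat w ` {x \<in> Vq M q. pre n x = v}" for v
  have bnd: "bounded (C v)" for v
  proof (rule bounded_subset[of "{0..?K}"])
    show "C v \<subseteq> {0..?K}" using proj_nonneg[OF q_gt_1 d] proj_le[OF q_gt_1 d] by (auto simp: C_def)
  qed simp
  have diam: "diameter (C v) \<le> ?K / q ^ n" for v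
  proof (rule diameter_le)
    fix a b assume "a \<in> C v" "b \<in> C v"
    then obtain x y where xy: "x \<in> Vq M q" "y \<in> Vq M q" "pre n x = v" "pre n y = v"
      "a = proj q (cat w x)" "b = proj q (cat w y)" by (auto simp: C_def)
    have "pre (length w + n) (cat w x) = pre (length w + n) (cat w y)" using xy by (simp add: pre_cat)
    then have "pre n (cat w x) = pre n (cat w y)" by (rule pre_eq_mono) simp
    then show "norm (a - b) \<le> ?K / q ^ n" using proj_close[OF q_gt_1 d[OF xy(1)] d[OF xy(2)]] xy by simp
  qed (use K0 q_gt_1 in auto)
  have "(\<Sum>v\<in>pre n ` Vq M q. diameter (C v) powr t) \<le> (\<Sum>v\<in>pre n ` Vq M q. (?K / q ^ n) powr t)"
    using diam t0 diameter_ge_0[OF bnd] by (intro sum_mono powr_mono2) auto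
  also have "\<dots> \<le> e" using n by simp
  finally have "(\<Sum>v\<in>pre n ` Vq M q. diameter (C v) powr t) \<le> e" .
  moreover have "diameter (C v) \<le> \<delta>" for v using diam[of v] n(1) by linarith
  moreover have "proj q ` cat w ` Vq M q \<subseteq> (\<Union>v\<in>pre n ` Vq M q. C v)" by (auto simp: C_def)
  ultimately show "\<exists>(F :: nat list set) C. finite F \<and> proj q ` cat w ` Vq M q \<subseteq> (\<Union>i\<in>F. C i)
    \<and> (\<forall>i\<in>F. bounded (C i) \<and> diameter (C i) \<le> \<delta>) \<and> (\<Sum>i\<in>F. diameter (C i) powr t) \<le> e"
    using finite_words_Vq bnd by (intro exI[of _ "pre n ` Vq M q"] exI[of _ C] conjI ballI) blast+
qed

text \<open>A countable union suffices: the values of the two constant sequences, and for each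
  finite word the image of the subshift with that word put in front.\<close>

lemma hausdorff_null_univoque:
  assumes t: "entropy M q / ln q < t"
  shows "hausdorff_measure t (univoque M q) = 0"
proof -
  define A where "A n = (let w = from_nat n in
    if set w \<subseteq> {..M} then proj q ` cat w ` Vq M q else {})" for n
  define P where "P n = (if n = 0 then {proj q (\<lambda>_. 0)} else if n = 1 then {proj q (\<lambda>_. M)} else A (n - 2))" for n
  have "hausdorff_measure t ({} :: real set) = 0"
    by (rule hausdorff_null_subset[OF hausdorff_null_singleton[of t 0]]) simp
  then have "hausdorff_measure t (P n) = 0" for n
    by (simp add: P_def A_def Let_def hausdorff_null_tail_Vq[OF t] hausdorff_null_singleton)
  then have null: "hausdorff_measure t (\<Union>n. P n) = 0" by (rule hausdorff_null_UN)
  have "univoque M q \<subseteq> (\<Union>n. P n)"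
  proof
    fix a assume "a \<in> univoque M q"
    then obtain x where x: "uniq x" "a = proj q x" by (auto simp: univoque_eq)
    consider "x = (\<lambda>_. 0)" | "x = (\<lambda>_. M)" | n where "shift n x \<in> Vq M q"
      using uniq_imp_eventually_Vq[OF x(1)] by blast
    then show "a \<in> (\<Union>n. P n)"
    proof cases
      case 1
      then have "a \<in> P 0" using x by (simp add: P_def)
      then show ?thesis by blast
    next
      case 2
      then have "a \<in> P 1" using x by (simp add: P_def)
      then show ?thesis by blast
    next
      case 3
      have "set (pre n x) \<subseteq> {..M}" using x(1) by (intro set_pre) (simp add: uniq_def)
      moreover have "a \<in> proj q ` cat (pre n x) ` Vq M q" using 3 x(2) by (metis cat_pre_shift image_eqI)
      ultimately have "a \<in> P (to_nat (pre n x) + 2)" by (simp add: P_def A_def)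
      then show ?thesis by blast
    qed
  qed
  with null show ?thesis by (rule hausdorff_null_subset)
qed

end

section \<open>Lower bounds for the dimension\<close>

lemma sum_interleave: "(\<Sum>i<2 * k. g i) = (\<Sum>i<k. g (2 * i) + g (2 * i + 1))"
  for g :: "nat \<Rightarrow> real"
  by (induction k) (simp_all add: algebra_simps)

lemma dist_le_diameter: "bounded S \<Longrightarrow> a \<in> S \<Longrightarrow> b \<in> S \<Longrightarrow> \<bar>a - b\<bar> \<le> diameter S" for a b :: real
  using diameter_bounded_bound[of S a b] by (simp add: dist_real_def)

text \<open>A set of diameter \<open>d \<le> 1\<close> lies in an interval of length
  \<open>2 d\<close>, which is at most \<open>2 d powr t\<close>. A cheap cover would then have
  total length below \<open>b - a\<close>; the countable set \<open>D\<close> has length 0.\<close>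

lemma interval_not_hausdorff_null:
  fixes a b :: real
  assumes ab: "a < b" and t: "t < 1" and D: "countable D" "{a<..<b} \<subseteq> A \<union> D"
  shows "hausdorff_measure t A \<noteq> 0"
proof
  assume null: "hausdorff_measure t A = 0"
  have "0 < (b - a) / 2" using ab by simp
  from hausdorff_null_cover[OF null zero_less_one this] obtain C where C: "A \<subseteq> (\<Union>i :: nat. C i)" "\<And>i. bounded (C i) \<and> diameter (C i) \<le> 1"
    "(\<Sum>i. ennreal (diameter (C i) powr t)) < ennreal ((b - a) / 2)"
    by blast
  \<comment> \<open>For empty \<open>C i\<close> the centre is arbitrary and the interval
    \<open>I i\<close> degenerates to a point.\<close>
  define x where "x i = (SOME y. y \<in> C i)" for i
  define I where "I i = {x i - diameter (C i)..x i + diameter (C i)}" for i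
  have d0: "0 \<le> diameter (C i)" for i using C(2) diameter_ge_0 by blast
  have "C i \<subseteq> I i" for i
  proof
    fix y assume y: "y \<in> C i"
    then have "x i \<in> C i" unfolding x_def by (rule someI)
    then show "y \<in> I i" using dist_le_diameter[of "C i" y "x i"] y C(2)[of i] by (auto simp: I_def)
  qed
  then have "(\<Union>i. C i) \<subseteq> (\<Union>i. I i)" by (intro UN_mono subset_refl)
  with C(1) have "A \<subseteq> (\<Union>i. I i)" by (rule order_trans)
  with D(2) have sub: "{a<..<b} \<subseteq> (\<Union>i. I i) \<union> D" by blast
  have I: "I i \<in> sets lborel" for i by (simp add: I_def)
  have UI: "(\<Union>i. I i) \<in> sets lborel" using I by (intro sets.countable_UN) blast
  have Dm: "D \<in> sets lborel" using countable_imp_null_set_lborel[OF D(1)] by (rule null_setsD2)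
  have "emeasure lborel {a<..<b} \<le> emeasure lborel ((\<Union>i. I i) \<union> D)"
    using sub sets.Un[OF UI Dm] by (rule emeasure_mono)
  also have "\<dots> \<le> emeasure lborel (\<Union>i. I i) + emeasure lborel D"
    using UI Dm by (rule emeasure_subadditive)
  also have "\<dots> = emeasure lborel (\<Union>i. I i)" using emeasure_lborel_countable[OF D(1)] by simp
  also have "\<dots> \<le> (\<Sum>i. emeasure lborel (I i))" using I by (intro emeasure_subadditive_countably) blast
  also have "\<dots> \<le> (\<Sum>i. 2 * ennreal (diameter (C i) powr t))"
  proof (intro suminf_le)
    fix i
    have "diameter (C i) \<le> diameter (C i) powr t"
      using d0[of i] C(2)[of i] t powr_mono'[of t 1 "diameter (C i)"] by (cases "diameter (C i) = 0") auto
    then have "ennreal (2 * diameter (C i)) \<le> ennreal (2 * diameter (C i) powr t)" by (intro ennreal_leI) simp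
    moreover have "emeasure lborel (I i) = ennreal (2 * diameter (C i))" using d0 by (simp add: I_def)
    ultimately show "emeasure lborel (I i) \<le> 2 * ennreal (diameter (C i) powr t)"
      by (simp add: ennreal_mult')
  qed auto
  also have "\<dots> = 2 * (\<Sum>i. ennreal (diameter (C i) powr t))" by simp
  also have "\<dots> < 2 * ennreal ((b - a) / 2)" using C(3) by (intro ennreal_mult_strict_left_mono) auto
  also have "\<dots> = ennreal (b - a)" using ennreal_mult'[of 2 "(b - a) / 2"] by (simp add: diff_divide_distrib)
  finally show False using ab by simp
qed

section \<open>From covers of values to covers by cylinders\<close>

context left_entropy_increase
begin

definition dimension :: real where
  "dimension = entropy M q / ln q"

lemma dimension_pos: "0 < dimension"
  using entropy_pos q_gt_1 by (simp add: dimension_def)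

text \<open>The exponent is determined here: the critical weight of a cylinder is its length scale
  \<open>1 / q ^ n\<close> to the power \<open>dimension\<close>.\<close>

lemma z_power_eq: "z ^ n = (1 / q ^ n) powr dimension"
proof -
  have "ln q \<noteq> 0" using q_gt_1 by simp
  then show ?thesis using q_gt_1 by (simp add: z_power powr_def dimension_def ln_div ln_realpow)
qed

lemma z_power_small:
  assumes "0 < e" shows "\<exists>n. z ^ n \<le> e"
  using real_arch_pow_inv[OF assms z_less_1] less_imp_le by blast

text \<open>The larger digit gains 1, the tail of \<open>x\<close> is worth at most 1, and by
  reflection the tail of \<open>y\<close> at least \<open>M / (q - 1) - 1\<close>. The difference is
  therefore at least this last number, scaled.\<close>

lemma proj_separated:
  assumes x: "x \<in> Vq M q" and y: "y \<in> Vq M q" and n: "\<forall>i<n. x i = y i" "x n < y n"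
  shows "(real M / (q - 1) - 1) / q ^ Suc n \<le> proj q y - proj q x"
proof -
  note dx = digits_Vq[OF x] and dy = digits_Vq[OF y]
  have "proj q (shift (Suc n) x) \<le> 1"
    using shift_Vq[OF x, of "Suc n"] by (intro proj_le_one) (auto simp: Vq_iff)
  moreover have "proj q (reflect M (shift (Suc n) y)) \<le> 1"
    using reflect_Vq[OF shift_Vq[OF y, of "Suc n"]] by (intro proj_le_one) (auto simp: Vq_iff)
  then have "real M / (q - 1) - 1 \<le> proj q (shift (Suc n) y)"
    using digits_shift[OF dy] q_gt_1 by (simp add: proj_reflect)
  moreover have "real (x n) + 1 \<le> real (y n)" using n by simp
  ultimately have "(real M / (q - 1) - 1) / q ^ Suc n
      \<le> (real (y n) + proj q (shift (Suc n) y) - (real (x n) + proj q (shift (Suc n) x))) / q ^ Suc n"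
    using q_gt_1 by (intro divide_right_mono) auto
  also have "\<dots> = proj q y - proj q x"
    using proj_step[OF q_gt_1 dx, of n] proj_step[OF q_gt_1 dy, of n] psum_cong[OF n(1), of q]
    by (simp add: add_divide_distrib diff_divide_distrib)
  finally show ?thesis .
qed

text \<open>Each covering set is replaced by the cylinder of the longest common prefix of its
  sequences. Separation bounds the weight of this cylinder by the diameter, so a cheap cover would
  violate \<open>followers_cover_weight\<close>.\<close>

lemma hausdorff_cylinder_nonnull:
  assumes qM: "q < real M + 1" and ne: "followers u \<noteq> {}" and t: "0 \<le> t" "t < dimension"
    and W: "set W \<subseteq> {..M}"
  shows "hausdorff_measure t (proj q ` cat W ` (followers u - exceptional)) \<noteq> 0"
proof
  assume null: "hausdorff_measure t (proj q ` cat W ` (followers u - exceptional)) = 0"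
  obtain c where c: "c > 0" "\<And>f :: nat \<Rightarrow> nat list. followers u \<subseteq> (\<Union>i. {y. pre (length (f i)) y = f i})
    \<Longrightarrow> \<exists>k. c \<le> (\<Sum>i<k. z ^ length (f i))"
    using followers_cover_weight[OF ne] by blast
  define c0 where "c0 = real M / (q - 1) - 1"
  have c0: "0 < c0" using qM q_gt_1 by (simp add: c0_def)
  \<comment> \<open>Two values first differing at \<open>n\<close> behind \<open>W\<close> are at
    least \<open>c0 / q ^ (n + 1 + length W)\<close> apart; \<open>\<kappa>\<close> times this is
    exactly \<open>1 / q ^ n\<close>.\<close>
  define \<kappa> where "\<kappa> = q ^ Suc (length W) / c0"
  have \<kappa>: "0 < \<kappa>" using c0 q_gt_1 by (simp add: \<kappa>_def)
  \<comment> \<open>Makes the diameter part contribute \<open>c / 4\<close>. With two sums of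
    \<open>\<epsilon> i\<close>, each at most \<open>c / 4\<close>, the total is
    \<open>3 / 4 * c\<close>, less than \<open>c\<close>.\<close>
  define e where "e = c / (4 * \<kappa> powr dimension)"
  have e: "0 < e" using c \<kappa> by (simp add: e_def)
  obtain C where C: "proj q ` cat W ` (followers u - exceptional) \<subseteq> (\<Union>i :: nat. C i)"
    "\<And>i. bounded (C i) \<and> diameter (C i) \<le> 1" "(\<Sum>i. ennreal (diameter (C i) powr t)) < ennreal e"
    using hausdorff_null_cover[OF null zero_less_one e] by blast
  \<comment> \<open>Allowance for single sequences, enclosed in cylinders as long as desired: those
    alone in their covering set, whose diameter may be 0, and the exceptional ones.\<close>
  define \<epsilon> where "\<epsilon> i = c / 4 * (1 / 2) ^ Suc i" for i :: nat
  have \<epsilon>0: "0 < \<epsilon> i" for i using c(1) by (simp add: \<epsilon>_def)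
  have \<epsilon>sum: "(\<Sum>i<k. \<epsilon> i) \<le> c / 4" for k
  proof -
    have "\<epsilon> sums (c / 4 * 1)" unfolding \<epsilon>_def by (intro sums_mult power_half_series)
    then show ?thesis using sum_le_suminf[of \<epsilon> "{..<k}"] \<epsilon>0 by (auto simp: sums_iff less_imp_le)
  qed
  define Z where "Z i = {y \<in> followers u - exceptional. proj q (cat W y) \<in> C i}" for i
  have "\<exists>v. Z i \<subseteq> {y. pre (length v) y = v}
      \<and> z ^ length v \<le> \<kappa> powr dimension * diameter (C i) powr t + \<epsilon> i" for i
  proof -
    define Y where "Y = Z i"
    have dC0: "0 \<le> \<kappa> powr dimension * diameter (C i) powr t" by simp
    show ?thesis
    proof (cases "\<exists>n. \<exists>x\<in>Y. \<exists>y\<in>Y. x n < y n")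
      case True
      define n where "n = (LEAST n. \<exists>x\<in>Y. \<exists>y\<in>Y. x n < y n)"
      from LeastI_ex[OF True, folded n_def] obtain x y where xy: "x \<in> Y" "y \<in> Y" "x n < y n" by blast
      have agree: "a i = b i" if "a \<in> Y" "b \<in> Y" "i < n" for a b i
        using not_less_Least[of i "\<lambda>n. \<exists>x\<in>Y. \<exists>y\<in>Y. x n < y n", folded n_def] that by (meson linorder_neqE_nat)
      have V: "x \<in> Vq M q" "y \<in> Vq M q" using xy followers_subset by (auto simp: Y_def Z_def)
      have d: "digits M (cat W x)" "digits M (cat W y)" using W digits_Vq[OF V(1)] digits_Vq[OF V(2)] by (auto simp: digits_cat)
      have "psum q (cat W x) (length W) = psum q (cat W y) (length W)"
        by (intro psum_cong) (simp add: cat_def)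
      then have "proj q (cat W y) - proj q (cat W x) = (proj q y - proj q x) / q ^ length W"
        using proj_cat[OF d(1)] proj_cat[OF d(2)] by (simp add: diff_divide_distrib)
      also have "\<dots> \<ge> (c0 / q ^ Suc n) / q ^ length W"
        unfolding c0_def using proj_separated[OF V] agree[OF xy(1,2)] xy(3) q_gt_1 by (intro divide_right_mono) auto
      also have "proj q (cat W y) - proj q (cat W x) \<le> diameter (C i)"
        using dist_le_diameter[of "C i" "proj q (cat W y)" "proj q (cat W x)"] C(2)[of i] xy(1,2) by (auto simp: Y_def Z_def)
      finally have diam: "(c0 / q ^ Suc n) / q ^ length W \<le> diameter (C i)" .
      have eq: "1 / q ^ n = \<kappa> * ((c0 / q ^ Suc n) / q ^ length W)"
        using c0 q_gt_1 by (simp add: \<kappa>_def)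
      have le: "1 / q ^ n \<le> \<kappa> * diameter (C i)" unfolding eq using diam \<kappa> by (intro mult_left_mono) auto
      have "0 < (c0 / q ^ Suc n) / q ^ length W" using c0 q_gt_1 by simp
      then have dpos: "0 < diameter (C i)" using diam by linarith
      have "z ^ n \<le> (\<kappa> * diameter (C i)) powr dimension"
        unfolding z_power_eq using le q_gt_1 dimension_pos by (intro powr_mono2) auto
      also have "\<dots> = \<kappa> powr dimension * diameter (C i) powr dimension" using \<kappa> dpos by (simp add: powr_mult)
      also have "\<dots> \<le> \<kappa> powr dimension * diameter (C i) powr t"
        using t dpos C(2)[of i] by (intro mult_left_mono powr_mono') auto
      finally have "z ^ n \<le> \<kappa> powr dimension * diameter (C i) powr t + \<epsilon> i" using \<epsilon>0[of i] by linarith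
      moreover have "Y \<subseteq> {w. pre n w = pre n x}" using agree xy(1) by (auto simp: pre_eq_iff)
      ultimately show ?thesis unfolding Y_def[symmetric] by (intro exI[of _ "pre n x"]) simp
    next
      case False
      then have eq: "a = b" if "a \<in> Y" "b \<in> Y" for a b using that by (meson ext linorder_neqE_nat)
      obtain n where n: "z ^ n \<le> \<epsilon> i" using z_power_small[OF \<epsilon>0] by blast
      obtain x where "Y \<subseteq> {x}" using eq by blast
      moreover have "z ^ n \<le> \<kappa> powr dimension * diameter (C i) powr t + \<epsilon> i" using n dC0 by linarith
      ultimately show ?thesis unfolding Y_def[symmetric] by (intro exI[of _ "pre n x"]) auto
    qed
  qed
  then have "\<forall>i. \<exists>v. Z i \<subseteq> {y. pre (length v) y = v}
      \<and> z ^ length v \<le> \<kappa> powr dimension * diameter (C i) powr t + \<epsilon> i" ..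
  from choice[OF this] obtain f where
    f: "\<And>i. Z i \<subseteq> {y. pre (length (f i)) y = f i}"
      "\<And>i. z ^ length (f i) \<le> \<kappa> powr dimension * diameter (C i) powr t + \<epsilon> i" by blast
  have "\<exists>v. pre (length v) (from_nat_into exceptional i) = v \<and> z ^ length v \<le> \<epsilon> i" for i
  proof -
    obtain n where "z ^ n \<le> \<epsilon> i" using z_power_small[OF \<epsilon>0] by blast
    then show ?thesis by (intro exI[of _ "pre n (from_nat_into exceptional i)"]) simp
  qed
  then obtain h where h: "\<And>i. pre (length (h i)) (from_nat_into exceptional i) = h i" "\<And>i. z ^ length (h i) \<le> \<epsilon> i"
    by metis
  \<comment> \<open>Even indices carry the cylinders from the cover, odd ones those around an
    enumeration of \<open>exceptional\<close>.\<close>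
  define F where "F n = (if even n then f (n div 2) else h (n div 2))" for n
  have Feo: "F (2 * i) = f i" "F (2 * i + 1) = h i" for i by (auto simp: F_def)
  have "followers u \<subseteq> (\<Union>i. {y. pre (length (F i)) y = F i})"
  proof
    fix y assume y: "y \<in> followers u"
    show "y \<in> (\<Union>i. {y. pre (length (F i)) y = F i})"
    proof (cases "y \<in> exceptional")
      case True
      then obtain i where "y = from_nat_into exceptional i"
        using from_nat_into_surj[OF countable_exceptional] by metis
      then have "pre (length (F (2 * i + 1))) y = F (2 * i + 1)" unfolding Feo using h(1) by simp
      then show ?thesis by blast
    next
      case False
      then obtain i where "proj q (cat W y) \<in> C i" using C(1) y by blast
      then have "pre (length (F (2 * i))) y = F (2 * i)" unfolding Feo using f(1)[of i] False y by (auto simp: Z_def)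
      then show ?thesis by blast
    qed
  qed
  then obtain k where "c \<le> (\<Sum>i<k. z ^ length (F i))" using c(2) by blast
  also have "\<dots> \<le> (\<Sum>i<2 * k. z ^ length (F i))" using z_pos by (intro sum_mono2) auto
  also have "\<dots> = (\<Sum>i<k. z ^ length (f i) + z ^ length (h i))" unfolding sum_interleave Feo ..
  also have "\<dots> \<le> (\<Sum>i<k. (\<kappa> powr dimension * diameter (C i) powr t + \<epsilon> i) + \<epsilon> i)"
    using f(2) h(2) by (intro sum_mono add_mono) auto
  also have "\<dots> = \<kappa> powr dimension * (\<Sum>i<k. diameter (C i) powr t) + (\<Sum>i<k. \<epsilon> i) + (\<Sum>i<k. \<epsilon> i)"
    by (simp add: sum.distrib sum_distrib_left)
  also have "\<dots> \<le> \<kappa> powr dimension * e + c / 4 + c / 4"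
  proof (intro add_mono \<epsilon>sum mult_left_mono)
    have "ennreal (\<Sum>i<k. diameter (C i) powr t) = (\<Sum>i<k. ennreal (diameter (C i) powr t))"
      by (simp add: sum_ennreal)
    also have "\<dots> \<le> (\<Sum>i. ennreal (diameter (C i) powr t))" by (intro sum_le_suminf) auto
    also have "\<dots> \<le> ennreal e" using C(3) by simp
    finally show "(\<Sum>i<k. diameter (C i) powr t) \<le> e" using e by (simp add: ennreal_le_iff)
  qed simp
  also have "\<dots> = 3 / 4 * c" using \<kappa> by (simp add: e_def)
  finally show False using c(1) by simp
qed

text \<open>Here \<open>\<alpha>\<close> is constantly \<open>M\<close>, so all weak inequalities
  hold automatically and only exceptional sequences can fail the strict ones.\<close>

lemma univoque_dense_at_top:
  assumes "q = real M + 1"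
  shows "{0..1} \<subseteq> univoque M q \<union> proj q ` exceptional"
proof
  fix a :: real assume a: "a \<in> {0..1}"
  have M: "0 < real M" using q_gt_1 assms by simp
  have top: "\<alpha> = (\<lambda>_. M)" using quasi_greedy_top[of M] M assms by simp
  have max: "lex_le y \<alpha>" if "digits M y" for y
    using digitsD[OF that] by (auto simp: top lex_le_iff_not_less lex_less_def not_less)
  obtain s where s: "digits M s" "proj q s = a"
    using expansion_exists[OF q_gt_1 q_le, of a] a assms M by auto
  show "a \<in> univoque M q \<union> proj q ` exceptional"
  proof (cases "s \<in> exceptional")
    case False
    have "shift (Suc n) s \<noteq> \<alpha>" "shift (Suc n) s \<noteq> reflect M \<alpha>" for n
      using False unfolding exceptional_def by (metis (mono_tags, lifting) mem_Collect_eq shift_0)+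
    moreover have "shift (Suc n) s = reflect M \<alpha>" if "shift (Suc n) (reflect M s) = \<alpha>" for n
      using that s(1) digits_shift by (metis reflect_reflect shift_reflect)
    ultimately have "uniq s" unfolding uniq_def lex_less_iff_le_neq
      using s(1) max digits_shift[OF s(1)] digits_shift[OF digits_reflect] by blast
    then show ?thesis using s(2) univoque_eq by auto
  qed (use s in auto)
qed

lemma hausdorff_local_nonnull:
  assumes t: "0 \<le> t" "t < dimension" and V: "open V" "univoque M q \<inter> V \<noteq> {}"
  shows "hausdorff_measure t (univoque M q \<inter> V) \<noteq> 0"
proof -
  obtain a where a: "a \<in> univoque M q" "a \<in> V" using V(2) by blast
  obtain r where r: "r > 0" "ball a r \<subseteq> V" using V(1) a(2) by (meson openE)
  show ?thesis
  proof (cases "q = real M + 1")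
    case True
    have M: "M \<ge> 1" using q_gt_1 True by simp
    have "dimension = 1" unfolding dimension_def using entropy_top[OF M] M True by simp
    moreover have "0 \<le> a" "a \<le> 1" using a(1) True M by (auto simp: univoque_def)
    moreover have "{max 0 (a - r)<..<min 1 (a + r)} \<subseteq> univoque M q \<inter> V \<union> proj q ` exceptional"
    proof
      fix x assume x: "x \<in> {max 0 (a - r)<..<min 1 (a + r)}"
      then have "x \<in> V" using r(2) by (intro subsetD[OF r(2)]) (auto simp: dist_real_def)
      moreover have "x \<in> univoque M q \<union> proj q ` exceptional" using x by (intro subsetD[OF univoque_dense_at_top[OF True]]) auto
      ultimately show "x \<in> univoque M q \<inter> V \<union> proj q ` exceptional" by blast
    qed
    ultimately show ?thesis
      using t r(1) countable_exceptional
      by (intro interval_not_hausdorff_null[of "max 0 (a - r)" "min 1 (a + r)" _ "proj q ` exceptional"]) auto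
  next
    case False
    then have qM: "q < real M + 1" using q_le by simp
    obtain x where x: "uniq x" "a = proj q x" using a(1) by (auto simp: univoque_eq)
    have dx: "digits M x" using x by (simp add: uniq_def)
    have "(\<lambda>n. (1 / q) ^ n) \<longlonglongrightarrow> 0" using q_gt_1 by (intro LIMSEQ_power_zero) auto
    from tendsto_mult_right_zero[OF this, of "real M / (q - 1)"]
    have "(\<lambda>n. real M / (q - 1) / q ^ n) \<longlonglongrightarrow> 0" by (simp add: power_divide)
    then have "\<forall>\<^sub>F n in sequentially. real M / (q - 1) / q ^ n < r" using r(1) by (rule order_tendstoD)
    from eventually_happens'[OF sequentially_bot this] obtain n where n: "real M / (q - 1) / q ^ n < r" by blast
    obtain L u where L: "L \<ge> n" "\<exists>y. cat u y \<in> Vq M q"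
      "\<And>y. cat u y \<in> Vq M q \<Longrightarrow> y \<notin> exceptional \<Longrightarrow> uniq (cat (pre L x) y)"
      using uniq_perturbation[OF x(1) Vq_nonempty, of n] by blast
    have sub: "proj q ` cat (pre L x) ` (followers u - exceptional) \<subseteq> univoque M q \<inter> V"
    proof clarify
      fix y assume y: "y \<in> followers u" "y \<notin> exceptional"
      let ?X = "cat (pre L x) y"
      have un: "uniq ?X" using L(3) y by (simp add: followers_def)
      have "pre L ?X = pre L x" using pre_length_cat[of "pre L x" y] by simp
      then have "pre n ?X = pre n x" using L(1) by (rule pre_eq_mono)
      then have "\<bar>proj q ?X - proj q x\<bar> < r"
        using proj_close[OF q_gt_1 _ dx, of ?X n] un n by (simp add: uniq_def)
      then have "proj q ?X \<in> ball a r" using x(2) by (simp add: dist_real_def abs_minus_commute)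
      then show "proj q ?X \<in> univoque M q \<inter> V" using r(2) un by (auto simp: univoque_eq)
    qed
    have "followers u \<noteq> {}" using L(2) by (auto simp: followers_def)
    then have "hausdorff_measure t (proj q ` cat (pre L x) ` (followers u - exceptional)) \<noteq> 0"
      using qM t set_pre[OF dx] by (intro hausdorff_cylinder_nonnull) auto
    then show ?thesis using hausdorff_null_subset[OF _ sub] by blast
  qed
qed

lemma hausdorff_dim_local:
  assumes "open V" "univoque M q \<inter> V \<noteq> {}"
  shows "hausdorff_dim (univoque M q \<inter> V) = dimension"
proof (rule hausdorff_dim_eqI)
  show "0 \<le> dimension" using dimension_pos by simp
  show "hausdorff_measure t (univoque M q \<inter> V) = 0" if "dimension < t" for t
    using hausdorff_null_subset[OF hausdorff_null_univoque Int_lower1] that unfolding dimension_def by blast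
  show "hausdorff_measure t (univoque M q \<inter> V) \<noteq> 0" if "0 \<le> t" "t < dimension" for t
    using hausdorff_local_nonnull that assms by blast
qed

end

theorem theorem1:
  fixes M :: nat and q :: real and V :: "real set"
  assumes "M \<ge> 1"
    and "q \<in> {q_KL M<..real M + 1}"
    and "q \<notin> (\<Union>{{pL<..pR} | pL pR. entropy_plateau M pL pR})"
    and "open V"
    and "univoque M q \<inter> V \<noteq> {}"
  shows "hausdorff_dim (univoque M q \<inter> V) = hausdorff_dim (univoque M q)"
proof -
  note incr = entropy_increases_at[OF assms(1-3)]
  interpret left_entropy_increase M q
    using incr assms(2) by unfold_locales auto
  \<comment> \<open>The whole set is the case \<open>V = UNIV\<close>, so both sides equal
    \<open>dimension\<close>.\<close>
  have "hausdorff_dim (univoque M q \<inter> UNIV) = dimension"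
    using assms(5) by (intro hausdorff_dim_local) auto
  then show ?thesis using hausdorff_dim_local[OF assms(4,5)] by simp
qed

end
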